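(* Let the smoothness-ABG assumption, the convexity assumption and the summability assumption hold, and let $(x_k)_{k\in\mathbb N}$ be generated by S-SZD from a deterministic $x_0\in\mathbb R^d$ with $l$ directions, step-sizes $(\alpha_k)$ and discretizations $(h_k)$. Suppose also that $\alpha_k\le\bar\alpha$ for all $k\in\mathbb N$, where $\bar\alpha>0$ satisfies $\bar\alpha\, d(A+\lambda B)/l<1$. Then: (1) $\lim_{k} f(x_k)=\min f$ almost surely, and there exists a random variable $x^*$ with values in $\operatorname{argmin} f$ such that $x_k\to x^*$ almost surely. (2) Let $\hat x_k:=\frac{1}{\sum_{j=0}^k\alpha_j}\sum_{j=0}^k\alpha_j x_j$. For every $\delta\in\left(0,\,1-d(A+\lambda B)\bar\alpha/l\right]$, every $\bar x\in\operatorname{argmin} f$ and every $k\in\mathbb N$, $$\mathbb E[f(\hat x_k)-f^*]\le \frac{1}{2\delta\sum_{j=0}^k\alpha_j}\left[S_k+\sum_{j=0}^k\rho_j\left(\sqrt{S_j}+\sum_{i=0}^j\rho_i\right)\right],$$ where, for every $k\in\mathbb N$, $$S_k:=\|x_0-\bar x\|^2+\sum_{j=0}^k W_j,\qquad W_k:=\frac dl\left(\frac{\lambda^2d^2}{2l}h_k^2+2G\right)\alpha_k^2,\qquad \rho_k:=\frac{\lambda d\sqrt d}{l}\,\alpha_kh_k .$$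
   Context: Setting. $1\le l\le d$ are integers, $\|\cdot\|$ is the Euclidean norm. $Z$ is a random variable with values in a measurable space $\mathcal Z$, $F:\mathbb R^d\times\mathcal Z\to\mathbb R$, $f(x):=\mathbb E[F(x,Z)]$, $f^*:=\inf f$, and $\nabla$ denotes the gradient in the variable $x$. Smoothness-ABG assumption. (i) There is $\lambda>0$ such that for every $z\in\mathcal Z$ the function $x\mapsto F(x,z)$ is differentiable with $\lambda$-Lipschitz gradient. (ii) $f(x)<+\infty$ for every $x\in\mathbb R^d$, $f$ is differentiable and has at least one minimizer. (iii) There are constants $A,B,G>0$ such that for every $x\in\mathbb R^d$, $\mathbb E[\|\nabla F(x,Z)\|^2]\le A(f(x)-f^* )+B\|\nabla f(x)\|^2+G$. Convexity assumption. For every $z\in\mathcal Z$ the map $x\mapsto F(x,z)$ is convex. Summability assumption. $\alpha_k>0$, $h_k>0$, $\sum_k\alpha_k=+\infty$, $\sum_k\alpha_k^2<+\infty$, $\sum_k\alpha_kh_k<+\infty$. Algorithm S-SZD. $(Z_k)_{k\in\mathbb N}$ are independent copies of $Z$. $(P_k)_{k\in\mathbb N}$ are random $d\times l$ matrices, each satisfying $\mathbb E[P_kP_k^\intercal]=I$ and $P_k^\intercal P_k=\frac dl I$ almost surely; all the $P_k$ and $Z_k$ are mutually independent. With $p_k^{(i)}$ the $i$-th column of $P_k$, the iteration is $$x_{k+1}=x_k-\alpha_k\sum_{i=1}^l\frac{F(x_k+h_kp_k^{(i)},Z_k)-F(x_k,Z_k)}{h_k}\,p_k^{(i)},\qquad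 k=0,1,2,\dots$$ *)

theory Defs
  imports "HOL-Probability.Probability"
begin

text \<open>Meaningful only where \<open>f\<close> is differentiable, which the theorem always assumes.\<close>

definition gradient :: "('a::real_inner \<Rightarrow> real) \<Rightarrow> 'a \<Rightarrow> 'a" where
  "gradient f x = (THE D. GDERIV f x :> D)"

definition argmin :: "('a \<Rightarrow> real) \<Rightarrow> 'a set" where
  "argmin f = {x. is_arg_min f (\<lambda>_. True) x}"

definition objective :: "'w measure \<Rightarrow> ('w \<Rightarrow> 'z) \<Rightarrow> ('a \<Rightarrow> 'z \<Rightarrow> real) \<Rightarrow> 'a \<Rightarrow> real" where
  "objective M Z F x = (\<integral>\<omega>. F x (Z \<omega>) \<partial>M)"

text \<open>
  The Bochner integral of a non-integrable function is \<open>0\<close>, so every finiteness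
  requirement on an expectation is stated as \<open>integrable\<close>.  In particular, a finite
  expectation \<open>objective M Z F x\<close> means that \<open>F x \<circ> Z\<close> is integrable.
\<close>

definition smoothness_ABG ::
    "'w measure \<Rightarrow> 'z measure \<Rightarrow> ('w \<Rightarrow> 'z) \<Rightarrow> ('a::euclidean_space \<Rightarrow> 'z \<Rightarrow> real)
      \<Rightarrow> real \<Rightarrow> real \<Rightarrow> real \<Rightarrow> real \<Rightarrow> bool" where
  "smoothness_ABG M \<Z> Z F lam A B G \<longleftrightarrow>
    (let f = objective M Z F; fstar = (INF x. f x) in
      lam > 0 \<and>
      (\<forall>z\<in>space \<Z>. (\<forall>x. (\<lambda>x. F x z) differentiable (at x)) \<and>
         lam-lipschitz_on UNIV (gradient (\<lambda>x. F x z))) \<and>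
      (\<forall>x. integrable M (\<lambda>\<omega>. F x (Z \<omega>))) \<and>
      (\<forall>x. f differentiable (at x)) \<and>
      argmin f \<noteq> {} \<and>
      A > 0 \<and> B > 0 \<and> G > 0 \<and>
      (\<forall>x. integrable M (\<lambda>\<omega>. (norm (gradient (\<lambda>x. F x (Z \<omega>)) x))\<^sup>2) \<and>
         (\<integral>\<omega>. (norm (gradient (\<lambda>x. F x (Z \<omega>)) x))\<^sup>2 \<partial>M)
           \<le> A * (f x - fstar) + B * (norm (gradient f x))\<^sup>2 + G))"

definition summability :: "(nat \<Rightarrow> real) \<Rightarrow> (nat \<Rightarrow> real) \<Rightarrow> bool" where
  "summability \<alpha> h \<longleftrightarrow>
    (\<forall>k. \<alpha> k > 0) \<and> (\<forall>k. h k > 0) \<and>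
    filterlim (\<lambda>n. \<Sum>k<n. \<alpha> k) at_top sequentially \<and>
    summable (\<lambda>k. (\<alpha> k)\<^sup>2) \<and>
    summable (\<lambda>k. \<alpha> k * h k)"

text \<open>
  Mutual independence of all the members of two sequences of random variables with
  different value types.  Since \<open>indep_vars\<close> needs one common value type, this is stated
  through the generated events, with the disjoint union of the two index sets as index set.
\<close>

definition (in prob_space) mutually_indep ::
    "(nat \<Rightarrow> 'a \<Rightarrow> 'b) \<Rightarrow> 'b measure \<Rightarrow> (nat \<Rightarrow> 'a \<Rightarrow> 'c) \<Rightarrow> 'c measure \<Rightarrow> bool" where
  "mutually_indep X S Y T \<longleftrightarrow>
    (\<forall>k. X k \<in> measurable M S) \<and> (\<forall>k. Y k \<in> measurable M T) \<and>
    indep_sets (case_sum (\<lambda>k. {X k -` A \<inter> space M | A. A \<in> sets S})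
                         (\<lambda>k. {Y k -` A \<inter> space M | A. A \<in> sets T})) UNIV"

text \<open>
  Deterministic recursion along one realisation of the directions and of the samples;
  the columns of \<open>P k\<close> are the directions used at step \<open>k\<close>.
\<close>

primrec sszd ::
    "(real^'d \<Rightarrow> 'z \<Rightarrow> real) \<Rightarrow> (nat \<Rightarrow> real) \<Rightarrow> (nat \<Rightarrow> real) \<Rightarrow> (nat \<Rightarrow> real^'l^'d)
      \<Rightarrow> (nat \<Rightarrow> 'z) \<Rightarrow> real^'d \<Rightarrow> nat \<Rightarrow> real^'d" where
  "sszd F \<alpha> h P z x0 0 = x0"
| "sszd F \<alpha> h P z x0 (Suc k) =
    (let x = sszd F \<alpha> h P z x0 k in
      x - \<alpha> k *\<^sub>R (\<Sum>i\<in>UNIV.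
        ((F (x + h k *\<^sub>R column i (P k)) (z k) - F x (z k)) / h k) *\<^sub>R column i (P k)))"

end

theory Submission
  imports Defs
begin

text \<open>The two hypotheses on the directions act separately. Orthogonality of the columns holds
  almost surely and gives \<open>\<Sum>i. r i *\<^sub>R column i p\<close> the squared norm
  \<open>d / l\<close> times the sum of the \<open>(r i)\<^sup>2\<close>; this produces the powers
  of d and l in \<open>\<rho>\<close> and \<open>W\<close>. The mean identity is used only linearly,
  to average products with exact gradients. The obstacle to almost sure convergence is the bias of
  finite differences: it leaves an error \<open>\<rho> k\<close> times the distance to the
  minimizer, and the distance is not known to be bounded. Absorbing this error pathwise by the
  squared distance would cost a factor \<open>1 + \<rho> k\<close> at each step. Averaging it first
  turns it into a number, at most \<open>\<rho> k\<close> times a uniform bound on the root mean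
  square distance, so that only additive errors remain. Hence moments are controlled before paths.
  Conditional expectations appear as integrals over events of the past. Since finiteness of the
  second moments is itself proved along the iteration, the one-step inequality is obtained first for
  nonnegative integrals, where nothing has to be integrable.\<close>

text \<open>
  Integrating the quadratic bound on \<open>F x z\<close> shows that \<open>\<nabla>f = E \<nabla>F\<close> and that \<open>f\<close> obeys the same
  bound; with convexity, \<open>\<langle>\<nabla>f(x), x - x*\<rangle> \<ge> f(x) - f* + \<parallel>\<nabla>f(x)\<parallel>\<^sup>2 / (2\<lambda>)\<close>.  The last
  term is what turns \<open>A + 2\<lambda>B\<close>, which \<open>\<parallel>\<nabla>f\<parallel>\<^sup>2 \<le> 2\<lambda>(f - f*)\<close> alone would give, into \<open>A + \<lambda>B\<close>.
  Freezing the past and integrating over the independent pair \<open>(Z\<^sub>k, P\<^sub>k)\<close> yields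
  \<open>E[\<parallel>x\<^sub>k\<^sub>+\<^sub>1 - x*\<parallel>\<^sup>2 | past] + 2\<delta>\<alpha>\<^sub>k(f(x\<^sub>k) - f*) \<le> \<parallel>x\<^sub>k - x*\<parallel>\<^sup>2 + \<rho>\<^sub>k\<parallel>x\<^sub>k - x*\<parallel> + W\<^sub>k\<close>.
  Taking expectations, a quadratic recursion bounds \<open>E\<parallel>x\<^sub>k - x*\<parallel>\<^sup>2\<close>, and Jensen gives the rate.
  As these second moments are bounded, \<open>\<parallel>x\<^sub>k - x*\<parallel>\<^sup>2\<close> is a nonnegative supermartingale up to
  summable constants, so it converges almost surely by the upcrossing argument; doing this for a countable
  dense set of minimizers and using \<open>\<Sum>\<alpha>\<^sub>k(f(x\<^sub>k) - f*) < \<infinity>\<close> identifies the limit.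
\<close>

subsection \<open>Gradients, smoothness and convexity\<close>

text \<open>The definite description in \<open>gradient\<close> requires existence and uniqueness.
  The vector of the values of the derivative on \<open>Basis\<close> represents it, and two
  representing vectors agree once tested against their difference.\<close>

lemma GDERIV_gradient:
  fixes f :: "'a::euclidean_space \<Rightarrow> real"
  assumes "f differentiable (at x)"
  shows "GDERIV f x :> gradient f x"
proof -
  obtain f' where f': "(f has_derivative f') (at x)"
    using assms unfolding differentiable_def by blast
  define D where "D = (\<Sum>b\<in>Basis. f' b *\<^sub>R b)"
  interpret bounded_linear f' using f' by (rule has_derivative_bounded_linear)
  have "f' h = h \<bullet> D" for h
  proof -
    have "f' h = f' (\<Sum>b\<in>Basis. (h \<bullet> b) *\<^sub>R b)" by (simp add: euclidean_representation)
    also have "\<dots> = h \<bullet> D"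
      by (simp add: sum scaleR D_def inner_sum_right mult.commute)
    finally show ?thesis .
  qed
  then have "f' = (\<lambda>h. h \<bullet> D)" by blast
  then have D: "GDERIV f x :> D" using f' by (simp add: gderiv_def)
  moreover have "E = D" if "GDERIV f x :> E" for E
  proof -
    have "(\<lambda>h. h \<bullet> E) = (\<lambda>h. h \<bullet> D)"
      using that D unfolding gderiv_def by (rule has_derivative_unique)
    then have "(E - D) \<bullet> E = (E - D) \<bullet> D" by metis
    then have "(E - D) \<bullet> (E - D) = 0" by (simp add: inner_diff_right)
    then show "E = D" by simp
  qed
  ultimately show ?thesis unfolding gradient_def by (rule theI)
qed

lemma gradient_eqI:
  fixes f :: "'a::euclidean_space \<Rightarrow> real"
  assumes "GDERIV f x :> D"
  shows "gradient f x = D"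
proof -
  have "f differentiable (at x)" using assms unfolding gderiv_def differentiable_def by blast
  then have "GDERIV f x :> gradient f x" by (rule GDERIV_gradient)
  then have "(\<lambda>h. h \<bullet> gradient f x) = (\<lambda>h. h \<bullet> D)"
    using assms unfolding gderiv_def by (rule has_derivative_unique)
  then have "(gradient f x - D) \<bullet> gradient f x = (gradient f x - D) \<bullet> D" by metis
  then have "(gradient f x - D) \<bullet> (gradient f x - D) = 0" by (simp add: inner_diff_right)
  then show ?thesis by simp
qed

lemma GDERIV_line:
  assumes "GDERIV f (x + t *\<^sub>R v) :> D"
  shows "((\<lambda>t. f (x + t *\<^sub>R v)) has_real_derivative v \<bullet> D) (at t)"
proof -
  have "((\<lambda>t. x + t *\<^sub>R v) has_derivative (\<lambda>s. s *\<^sub>R v)) (at t)"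
    by (auto intro!: derivative_eq_intros)
  moreover have "(f has_derivative (\<lambda>h. h \<bullet> D)) (at (x + t *\<^sub>R v))"
    using assms by (simp add: gderiv_def)
  ultimately have "((\<lambda>t. f (x + t *\<^sub>R v)) has_derivative (\<lambda>s. (s *\<^sub>R v) \<bullet> D)) (at t)"
    by (rule has_derivative_compose)
  then show ?thesis by (simp add: has_field_derivative_def mult.commute[of _ "v \<bullet> D"])
qed

text \<open>Along the segment from \<open>x\<close> to \<open>y\<close>, subtracting the quadratic
  from plus or minus the linearization error leaves a function with nonpositive derivative.
  Comparing its values at 0 and 1 replaces an integral of the gradient.\<close>

lemma lipschitz_gradient_quadratic_bound:
  fixes f :: "'a::real_inner \<Rightarrow> real"
  assumes der: "\<And>x. GDERIV f x :> g x"
    and lip: "\<And>x y. norm (g x - g y) \<le> L * norm (x - y)"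
  shows "\<bar>f y - f x - g x \<bullet> (y - x)\<bar> \<le> L / 2 * (norm (y - x))\<^sup>2"
proof -
  define v where "v = y - x"
  have bound: "\<bar>v \<bullet> g (x + t *\<^sub>R v) - g x \<bullet> v\<bar> \<le> L * t * (norm v)\<^sup>2" if "0 \<le> t" for t
  proof -
    have "\<bar>v \<bullet> g (x + t *\<^sub>R v) - g x \<bullet> v\<bar> = \<bar>v \<bullet> (g (x + t *\<^sub>R v) - g x)\<bar>"
      by (simp add: inner_diff_right inner_commute)
    also have "\<dots> \<le> norm v * norm (g (x + t *\<^sub>R v) - g x)"
      by (rule Cauchy_Schwarz_ineq2)
    also have "\<dots> \<le> norm v * (L * norm ((x + t *\<^sub>R v) - x))"
      by (intro mult_left_mono lip) simp
    finally show ?thesis using that by (simp add: power2_eq_square mult_ac)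
  qed
  define up where "up t = f (x + t *\<^sub>R v) - t * (g x \<bullet> v) - L / 2 * t\<^sup>2 * (norm v)\<^sup>2" for t
  define lo where "lo t = - f (x + t *\<^sub>R v) + t * (g x \<bullet> v) - L / 2 * t\<^sup>2 * (norm v)\<^sup>2" for t
  have "up 1 \<le> up 0"
  proof (rule DERIV_nonpos_imp_nonincreasing[where f = up])
    fix t :: real assume t: "0 \<le> t" "t \<le> 1"
    have "(up has_real_derivative v \<bullet> g (x + t *\<^sub>R v) - g x \<bullet> v - L * t * (norm v)\<^sup>2) (at t)"
      unfolding up_def by (rule derivative_eq_intros GDERIV_line der refl | simp)+
    then show "\<exists>y. (up has_real_derivative y) (at t) \<and> y \<le> 0"
      using bound[OF t(1)] by fastforce
  qed simp
  moreover have "lo 1 \<le> lo 0"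
  proof (rule DERIV_nonpos_imp_nonincreasing[where f = lo])
    fix t :: real assume t: "0 \<le> t" "t \<le> 1"
    have "(lo has_real_derivative - (v \<bullet> g (x + t *\<^sub>R v)) + g x \<bullet> v - L * t * (norm v)\<^sup>2) (at t)"
      unfolding lo_def by (rule derivative_eq_intros GDERIV_line der refl | simp)+
    then show "\<exists>y. (lo has_real_derivative y) (at t) \<and> y \<le> 0"
      using bound[OF t(1)] by fastforce
  qed simp
  ultimately show ?thesis unfolding up_def lo_def v_def by (simp add: abs_real_def)
qed

lemma convex_on_gradient_ineq:
  fixes f :: "'a::real_inner \<Rightarrow> real"
  assumes conv: "convex_on UNIV f" and der: "GDERIV f x :> D"
  shows "f x + D \<bullet> (y - x) \<le> f y"
proof -
  define v where "v = y - x"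
  have "convex_on UNIV (\<lambda>t::real. f (x + t *\<^sub>R v))"
  proof (rule convex_onI)
    fix t a b :: real assume t: "0 < t" "t < 1"
    have "x + ((1 - t) *\<^sub>R a + t *\<^sub>R b) *\<^sub>R v = (1 - t) *\<^sub>R (x + a *\<^sub>R v) + t *\<^sub>R (x + b *\<^sub>R v)"
      by (simp add: algebra_simps)
    then show "f (x + ((1 - t) *\<^sub>R a + t *\<^sub>R b) *\<^sub>R v) \<le> (1 - t) * f (x + a *\<^sub>R v) + t * f (x + b *\<^sub>R v)"
      using convex_onD[OF conv, of t "x + a *\<^sub>R v" "x + b *\<^sub>R v"] t by simp
  qed simp
  moreover have "((\<lambda>t. f (x + t *\<^sub>R v)) has_real_derivative v \<bullet> D) (at 0)"
    by (rule GDERIV_line) (simp add: der)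
  ultimately have "f (x + 1 *\<^sub>R v) - f (x + 0 *\<^sub>R v) \<ge> (v \<bullet> D) * (1 - 0)"
    by (intro convex_on_imp_above_tangent[where A = UNIV]) auto
  then show ?thesis by (simp add: v_def inner_commute)
qed

text \<open>A discrete Gronwall argument for a square-root nonlinearity. If \<open>m\<close> is the
  largest \<open>sqrt (u i)\<close> up to time \<open>k\<close>, then replacing every root in the
  recursion by \<open>m\<close> gives the scalar inequality
  \<open>m\<^sup>2 \<le> S k + R * m\<close>, which bounds \<open>m\<close>.\<close>

lemma sqrt_bound_of_recursion:
  fixes u S \<rho> :: "nat \<Rightarrow> real"
  assumes rec: "\<And>k. u (Suc k) \<le> S k + (\<Sum>j=0..k. \<rho> j * sqrt (u j))" and u0: "u 0 \<le> S 0"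
    and S: "mono S" and u: "\<And>k. 0 \<le> u k" and \<rho>: "\<And>k. 0 \<le> \<rho> k"
  shows "sqrt (u k) \<le> sqrt (S k) + (\<Sum>j=0..k. \<rho> j)"
proof -
  define m where "m = Max ((\<lambda>i. sqrt (u i)) ` {0..k})"
  have le_m: "sqrt (u i) \<le> m" if "i \<le> k" for i
    unfolding m_def using that by (intro Max_ge) auto
  have "m \<in> (\<lambda>i. sqrt (u i)) ` {0..k}" unfolding m_def by (intro Max_in) auto
  then obtain i where i: "i \<le> k" "m = sqrt (u i)" by auto
  have m0: "0 \<le> m" using i u by simp
  have S0: "0 \<le> S k" using order_trans[OF u[of 0] u0] monoD[OF S, of 0 k] by simp
  define R where "R = (\<Sum>j=0..k. \<rho> j)"
  have R0: "0 \<le> R" unfolding R_def by (intro sum_nonneg \<rho>)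
  have sq: "m\<^sup>2 \<le> S k + R * m"
  proof (cases i)
    case 0
    then have "m\<^sup>2 \<le> S k" using i u u0 monoD[OF S, of 0 k] by simp
    then show ?thesis using R0 m0 by (simp add: add_increasing2)
  next
    case (Suc n)
    have "m\<^sup>2 = u (Suc n)" using i u Suc by simp
    also have "\<dots> \<le> S n + (\<Sum>j=0..n. \<rho> j * sqrt (u j))" by (rule rec)
    also have "\<dots> \<le> S k + (\<Sum>j=0..n. \<rho> j * m)"
      using i Suc by (intro add_mono monoD[OF S] sum_mono mult_left_mono le_m \<rho>) auto
    also have "\<dots> \<le> S k + (\<Sum>j=0..k. \<rho> j * m)"
      using i Suc by (intro add_mono sum_mono2) (use \<rho> m0 in auto)
    finally show ?thesis by (simp add: R_def sum_distrib_right)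
  qed
  \<comment> \<open>If \<open>m\<close> exceeded the bound, then
    \<open>m * m > m * sqrt (S k) + R * m \<ge> S k + R * m\<close>, against
    \<open>sq\<close>.\<close>
  have "m \<le> sqrt (S k) + R"
  proof (rule ccontr)
    assume "\<not> m \<le> sqrt (S k) + R"
    then have gt: "sqrt (S k) + R < m" by simp
    then have "m > 0" using S0 R0 by (smt (verit) real_sqrt_ge_zero)
    then have "m * (sqrt (S k) + R) < m * m" using gt by simp
    moreover have "sqrt (S k) * sqrt (S k) \<le> m * sqrt (S k)"
      using gt R0 S0 by (intro mult_right_mono) auto
    ultimately show False using sq S0 by (simp add: power2_eq_square algebra_simps)
  qed
  then show ?thesis using le_m[of k] by (simp add: R_def)
qed

subsection \<open>Upcrossings and almost supermartingales\<close>

text \<open>Doob's betting strategy: hold from the first value below \<open>a\<close> until the first value above \<open>b\<close>.\<close>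

primrec in_upcrossing :: "real \<Rightarrow> real \<Rightarrow> (nat \<Rightarrow> real) \<Rightarrow> nat \<Rightarrow> bool" where
  "in_upcrossing a b u 0 \<longleftrightarrow> u 0 < a"
| "in_upcrossing a b u (Suc k) \<longleftrightarrow> (if in_upcrossing a b u k then u (Suc k) \<le> b else u (Suc k) < a)"

primrec upcrossings :: "real \<Rightarrow> real \<Rightarrow> (nat \<Rightarrow> real) \<Rightarrow> nat \<Rightarrow> nat" where
  "upcrossings a b u 0 = 0"
| "upcrossings a b u (Suc k) =
    upcrossings a b u k + (if in_upcrossing a b u k \<and> b < u (Suc k) then 1 else 0)"

text \<open>Each completed upcrossing earns at least \<open>b - a\<close>, because the position was
  opened below \<open>a\<close> and closed above \<open>b\<close>. The second summand on the left
  values a position still open; it makes the induction go through and may be negative.\<close>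

lemma upcrossings_gain:
  "(b - a) * real (upcrossings a b u k) + (if in_upcrossing a b u k then u k - a else 0)
    \<le> (\<Sum>j<k. if in_upcrossing a b u j then u (Suc j) - u j else 0)"
proof (induction k)
  case (Suc k)
  then show ?case by (auto simp: algebra_simps)
qed simp

lemma incseq_upcrossings: "incseq (upcrossings a b u)"
  by (rule incseq_SucI) simp

text \<open>If the count were bounded, it would be constant from some \<open>k0\<close> on. A
  position held after \<open>k0\<close> could then never be closed; but a later value below
  \<open>a\<close> ensures that one is held, and a still later value above \<open>b\<close> closes
  it.\<close>

lemma upcrossings_unbounded:
  assumes a: "\<exists>\<^sub>F k in sequentially. u k < a" and b: "\<exists>\<^sub>F k in sequentially. b < u k"
  shows "\<exists>k. n < upcrossings a b u k"
proof (rule ccontr)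
  assume "\<not> ?thesis"
  then have "\<forall>k. upcrossings a b u k < Suc n" by (simp add: not_less less_Suc_eq_le)
  then obtain k0 where k0: "\<And>k. upcrossings a b u k \<le> upcrossings a b u k0"
    using ex_has_greatest_nat[of "\<lambda>_. True" 0 "upcrossings a b u" "Suc n"] by auto
  have stay: "u (Suc k) \<le> b" if "in_upcrossing a b u k" "k0 \<le> k" for k
  proof (rule ccontr)
    assume "\<not> u (Suc k) \<le> b"
    then have "upcrossings a b u (Suc k) = Suc (upcrossings a b u k)" using that by simp
    moreover have "upcrossings a b u k0 \<le> upcrossings a b u k"
      using incseqD[OF incseq_upcrossings that(2)] .
    ultimately show False using k0[of "Suc k"] by simp
  qed
  obtain m where m: "m > k0" "u m < a" using a unfolding frequently_sequentially by (metis Suc_le_lessD)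
  then obtain m' where m': "m = Suc m'" by (cases m) auto
  obtain k1 where k1: "k1 \<ge> k0" "in_upcrossing a b u k1"
  proof (cases "in_upcrossing a b u m'")
    case True then show ?thesis using that[of m'] m m' by simp
  next
    case False then show ?thesis using that[of m] m m' by simp
  qed
  have inj: "in_upcrossing a b u j" if "j \<ge> k1" for j
    using that
  proof (induction j rule: dec_induct)
    case (step j) then show ?case using stay[of j] k1 by simp
  qed (rule k1)
  obtain j where j: "j > k1" "b < u j" using b unfolding frequently_sequentially by (metis Suc_le_lessD)
  then obtain j' where j': "j = Suc j'" by (cases j) auto
  have "u j \<le> b" using stay[OF inj[of j']] j j' k1 by simp
  then show False using j by simp
qed

text \<open>Two rationals strictly between the lower and upper limits would be crossed infinitely
  often. Rational levels suffice, so that a random sequence has only countably many exceptional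
  events. The hypothesis \<open>fin\<close> excludes divergence to infinity.\<close>

lemma converges_if_no_upcrossings:
  fixes u :: "nat \<Rightarrow> real"
  assumes nn: "\<And>k. 0 \<le> u k"
    and fin: "\<exists>\<^sub>F k in sequentially. u k < K"
    and bdd: "\<And>a b::rat. a < b \<Longrightarrow> \<exists>n. \<forall>k. upcrossings (of_rat a) (of_rat b) u k \<le> n"
  shows "convergent u"
proof -
  let ?I = "liminf (\<lambda>k. ereal (u k))" and ?S = "limsup (\<lambda>k. ereal (u k))"
  have "?I = ?S"
  proof (rule ccontr)
    assume "?I \<noteq> ?S"
    then have "?I < ?S" using Liminf_le_Limsup[of sequentially "\<lambda>k. ereal (u k)"] by (auto simp: less_le)
    then obtain r where r: "?I < ereal (of_rat r)" "ereal (of_rat r) < ?S"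
      using ereal_dense3 by blast
    then obtain s where s: "ereal (of_rat r) < ereal (of_rat s)" "ereal (of_rat s) < ?S"
      using ereal_dense3 by blast
    have "\<exists>\<^sub>F k in sequentially. u k < of_rat r"
    proof (rule ccontr)
      assume "\<not> ?thesis"
      then have "\<forall>\<^sub>F k in sequentially. ereal (of_rat r) \<le> ereal (u k)"
        by (simp add: not_frequently not_less)
      from Liminf_bounded[OF this] r show False by simp
    qed
    moreover have "\<exists>\<^sub>F k in sequentially. of_rat s < u k"
    proof (rule ccontr)
      assume "\<not> ?thesis"
      then have "\<forall>\<^sub>F k in sequentially. ereal (u k) \<le> ereal (of_rat s)"
        by (simp add: not_frequently not_less)
      from Limsup_bounded[OF this] s show False by simp
    qed
    moreover have "r < s" using s by (simp add: of_rat_less)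
    ultimately show False using bdd[of r s] upcrossings_unbounded by (metis not_less)
  qed
  moreover have "?I \<noteq> \<infinity>"
  proof
    assume "?I = \<infinity>"
    then have "\<forall>\<^sub>F k in sequentially. ereal K < ereal (u k)" by (intro less_LiminfD) simp
    then have "\<forall>\<^sub>F k in sequentially. \<not> u k < K" by eventually_elim simp
    with fin show False by (simp add: frequently_def)
  qed
  moreover have "0 \<le> ?I" by (intro Liminf_bounded) (simp add: nn)
  ultimately obtain L where L: "?I = ereal L" "?S = ereal L" by (cases ?S) auto
  then have "(\<lambda>k. ereal (u k)) \<longlonglongrightarrow> ereal L" by (intro iffD2[OF tendsto_iff_Liminf_eq_Limsup]) auto
  then show ?thesis by (auto simp: convergent_def)
qed

text \<open>Doob's argument with additive errors: betting on events of the past, one gains at most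
  the sum of the \<open>c k\<close> on average, while the gain dominates the number of upcrossings
  up to a constant. Testing \<open>step\<close> on all past events replaces a conditional
  expectation.\<close>

lemma (in prob_space) almost_supermartingale_converges:
  fixes U :: "nat \<Rightarrow> 'a \<Rightarrow> real"
  assumes subM: "\<And>k. subalgebra M (Fi k)" and sub: "\<And>k. subalgebra (Fi (Suc k)) (Fi k)"
    and meas: "\<And>k. U k \<in> borel_measurable (Fi k)"
    and int: "\<And>k. integrable M (U k)" and nn: "\<And>k \<omega>. 0 \<le> U k \<omega>"
    and step: "\<And>k A. A \<in> sets (Fi k) \<Longrightarrow>
      (\<integral>\<omega>. indicator A \<omega> * U (Suc k) \<omega> \<partial>M) \<le> (\<integral>\<omega>. indicator A \<omega> * U k \<omega> \<partial>M) + c k"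
    and c: "summable c" and c0: "\<And>k. 0 \<le> c k"
  shows "AE \<omega> in M. convergent (\<lambda>k. U k \<omega>)"
proof -
  have [measurable]: "U k \<in> borel_measurable M" for k
    using int by (rule borel_measurable_integrable)
  have int_ind: "integrable M (\<lambda>\<omega>. indicator A \<omega> * U k \<omega>)" if "A \<in> sets M" for A k
    using integrable_mult_indicator[OF that int[of k]] by simp
  have sum_c: "(\<Sum>j<k. c j) \<le> suminf c" for k
    by (rule sum_le_suminf[OF c]) (auto simp: c0)
  have bounded: "AE \<omega> in M. \<exists>n. \<forall>k. upcrossings a b (\<lambda>j. U j \<omega>) k \<le> n" if ab: "a < b" for a b
  proof -
    define H where "H k = {\<omega> \<in> space M. in_upcrossing a b (\<lambda>j. U j \<omega>) k}" for k
    \<comment> \<open>Whether a position is held at time \<open>k\<close> depends only on the values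
      up to \<open>k\<close>, so \<open>step\<close> applies to \<open>H k\<close>.\<close>
    have predF: "Measurable.pred (Fi k) (\<lambda>\<omega>. in_upcrossing a b (\<lambda>j. U j \<omega>) k)" for k
    proof (induction k)
      case 0
      have [measurable]: "U 0 \<in> borel_measurable (Fi 0)" by (rule meas)
      show ?case by simp
    next
      case (Suc k)
      have [measurable]: "U (Suc k) \<in> borel_measurable (Fi (Suc k))" by (rule meas)
      have [measurable]: "Measurable.pred (Fi (Suc k)) (\<lambda>\<omega>. in_upcrossing a b (\<lambda>j. U j \<omega>) k)"
        using sub Suc by (rule measurable_from_subalg)
      show ?case by simp
    qed
    have HF: "H k \<in> sets (Fi k)" for k
      using predF[of k] subM[of k] unfolding H_def pred_def subalgebra_def by simp
    then have HM [measurable]: "H k \<in> sets M" for k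
      using subM[of k] unfolding subalgebra_def by blast
    have [measurable]: "Measurable.pred M (\<lambda>\<omega>. in_upcrossing a b (\<lambda>j. U j \<omega>) k)" for k
      using subM predF by (rule measurable_from_subalg)
    have N [measurable]: "(\<lambda>\<omega>. real (upcrossings a b (\<lambda>j. U j \<omega>) k)) \<in> borel_measurable M" for k
      by (induction k) (simp_all add: if_distrib cong: if_cong)
    define gain where "gain k \<omega> = (\<Sum>j<k. indicator (H j) \<omega> * U (Suc j) \<omega> - indicator (H j) \<omega> * U j \<omega>)"
      for k \<omega>
    have int_gain: "integrable M (gain k)" for k
      unfolding gain_def by (intro Bochner_Integration.integrable_sum Bochner_Integration.integrable_diff int_ind HM)
    have E_gain: "(\<integral>\<omega>. gain k \<omega> \<partial>M) \<le> suminf c" for k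
    proof -
      have "(\<integral>\<omega>. gain k \<omega> \<partial>M)
          = (\<Sum>j<k. (\<integral>\<omega>. indicator (H j) \<omega> * U (Suc j) \<omega> \<partial>M) - (\<integral>\<omega>. indicator (H j) \<omega> * U j \<omega> \<partial>M))"
        unfolding gain_def by (subst Bochner_Integration.integral_sum) (auto simp: int_ind)
      also have "\<dots> \<le> (\<Sum>j<k. c j)"
        using step[OF HF] by (intro sum_mono) (simp add: algebra_simps)
      finally show ?thesis using sum_c[of k] by simp
    qed
    \<comment> \<open>The term \<open>\<bar>a\<bar>\<close> covers the loss on an open position:
      \<open>U k - a \<ge> - a\<close> since \<open>U k\<close> is nonnegative.\<close>
    have le_gain: "(b - a) * real (upcrossings a b (\<lambda>j. U j \<omega>) k) \<le> gain k \<omega> + \<bar>a\<bar>"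
      if "\<omega> \<in> space M" for k \<omega>
    proof -
      have "gain k \<omega> = (\<Sum>j<k. if in_upcrossing a b (\<lambda>j. U j \<omega>) j then U (Suc j) \<omega> - U j \<omega> else 0)"
        unfolding gain_def using that by (intro sum.cong) (auto simp: H_def)
      then show ?thesis
        using upcrossings_gain[of b a "\<lambda>j. U j \<omega>" k] nn[of k \<omega>] by (auto split: if_splits)
    qed
    define N' where "N' k \<omega> = ennreal ((b - a) * real (upcrossings a b (\<lambda>j. U j \<omega>) k))" for k \<omega>
    have [measurable]: "N' k \<in> borel_measurable M" for k unfolding N'_def by measurable
    have E_N': "(\<integral>\<^sup>+\<omega>. N' k \<omega> \<partial>M) \<le> ennreal (suminf c + \<bar>a\<bar>)" for k
    proof -
      have "(\<integral>\<^sup>+\<omega>. N' k \<omega> \<partial>M) \<le> (\<integral>\<^sup>+\<omega>. ennreal (gain k \<omega> + \<bar>a\<bar>) \<partial>M)"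
        unfolding N'_def by (intro nn_integral_mono ennreal_leI le_gain)
      also have "\<dots> = ennreal (\<integral>\<omega>. gain k \<omega> + \<bar>a\<bar> \<partial>M)"
      proof (intro nn_integral_eq_integral AE_I2)
        fix \<omega> assume "\<omega> \<in> space M"
        have "0 \<le> (b - a) * real (upcrossings a b (\<lambda>j. U j \<omega>) k)" using ab by simp
        then show "0 \<le> gain k \<omega> + \<bar>a\<bar>" using le_gain[OF \<open>\<omega> \<in> space M\<close>, of k] by linarith
      qed (use int_gain in simp)
      also have "\<dots> \<le> ennreal (suminf c + \<bar>a\<bar>)"
        using E_gain[of k] int_gain[of k] by (intro ennreal_leI) (simp add: prob_space)
      finally show ?thesis .
    qed
    have "incseq N'"
      unfolding N'_def using ab
      by (auto simp: incseq_def le_fun_def intro!: ennreal_leI mult_left_mono incseqD[OF incseq_upcrossings])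
    then have "(\<integral>\<^sup>+\<omega>. (SUP k. N' k \<omega>) \<partial>M) = (SUP k. \<integral>\<^sup>+\<omega>. N' k \<omega> \<partial>M)"
      by (rule nn_integral_monotone_convergence_SUP) simp
    also have "\<dots> \<le> ennreal (suminf c + \<bar>a\<bar>)" by (intro SUP_least E_N')
    finally have "(\<integral>\<^sup>+\<omega>. (SUP k. N' k \<omega>) \<partial>M) \<noteq> \<infinity>"
      by (metis ennreal_neq_top infinity_ennreal_def top_unique)
    then have "AE \<omega> in M. (SUP k. N' k \<omega>) \<noteq> \<infinity>" by (intro nn_integral_PInf_AE) auto
    then show ?thesis
    proof eventually_elim
      case (elim \<omega>)
      then obtain r where r: "0 \<le> r" "(SUP k. N' k \<omega>) = ennreal r" by (cases "SUP k. N' k \<omega>") auto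
      have "upcrossings a b (\<lambda>j. U j \<omega>) k \<le> nat \<lceil>r / (b - a)\<rceil>" for k
      proof -
        have "N' k \<omega> \<le> ennreal r" unfolding r(2)[symmetric] by (rule SUP_upper) simp
        then have "(b - a) * real (upcrossings a b (\<lambda>j. U j \<omega>) k) \<le> r"
          unfolding N'_def using r(1) by (simp add: ennreal_le_iff)
        then have "real (upcrossings a b (\<lambda>j. U j \<omega>) k) \<le> r / (b - a)" using ab by (simp add: field_simps)
        then show ?thesis by linarith
      qed
      then show ?case by blast
    qed
  qed
  have "AE \<omega> in M. \<forall>a b::rat. a < b \<longrightarrow> (\<exists>n. \<forall>k. upcrossings (of_rat a) (of_rat b) (\<lambda>j. U j \<omega>) k \<le> n)"
    using bounded by (simp add: AE_all_countable of_rat_less)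
  \<comment> \<open>Counting upcrossings does not detect escape to infinity. Fatou's lemma and the
    bounded expectations exclude it.\<close>
  moreover have "AE \<omega> in M. liminf (\<lambda>k. ennreal (U k \<omega>)) \<noteq> \<infinity>"
  proof (rule nn_integral_PInf_AE)
    have E_U: "(\<integral>\<omega>. U k \<omega> \<partial>M) \<le> (\<integral>\<omega>. U 0 \<omega> \<partial>M) + (\<Sum>j<k. c j)" for k
    proof (induction k)
      case (Suc k)
      have "(\<integral>\<omega>. U k \<omega> \<partial>M) = (\<integral>\<omega>. indicator (space M) \<omega> * U k \<omega> \<partial>M)" for k
        by (intro Bochner_Integration.integral_cong) auto
      moreover have "space M \<in> sets (Fi k)"
        using subM[of k] sets.top[of "Fi k"] unfolding subalgebra_def by simp
      ultimately show ?case using step[of "space M" k] Suc by simp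
    qed simp
    have "(\<integral>\<^sup>+\<omega>. liminf (\<lambda>k. ennreal (U k \<omega>)) \<partial>M) \<le> liminf (\<lambda>k. \<integral>\<^sup>+\<omega>. ennreal (U k \<omega>) \<partial>M)"
      by (rule nn_integral_liminf) simp
    also have "\<dots> \<le> ennreal ((\<integral>\<omega>. U 0 \<omega> \<partial>M) + suminf c)"
    proof (rule Liminf_le)
      show "\<forall>\<^sub>F k in sequentially. (\<integral>\<^sup>+\<omega>. ennreal (U k \<omega>) \<partial>M) \<le> ennreal ((\<integral>\<omega>. U 0 \<omega> \<partial>M) + suminf c)"
      proof (rule always_eventually, rule allI)
        fix k
        have "(\<integral>\<^sup>+\<omega>. ennreal (U k \<omega>) \<partial>M) = ennreal (\<integral>\<omega>. U k \<omega> \<partial>M)"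
          by (rule nn_integral_eq_integral[OF int]) (simp add: nn)
        then show "(\<integral>\<^sup>+\<omega>. ennreal (U k \<omega>) \<partial>M) \<le> ennreal ((\<integral>\<omega>. U 0 \<omega> \<partial>M) + suminf c)"
          using E_U[of k] sum_c[of k] by (simp add: ennreal_leI)
      qed
    qed simp
    finally show "(\<integral>\<^sup>+\<omega>. liminf (\<lambda>k. ennreal (U k \<omega>)) \<partial>M) \<noteq> \<infinity>"
      by (metis ennreal_neq_top infinity_ennreal_def top_unique)
  qed simp
  ultimately show ?thesis
  proof eventually_elim
    case (elim \<omega>)
    then obtain r where r: "0 \<le> r" "liminf (\<lambda>k. ennreal (U k \<omega>)) = ennreal r"
      by (cases "liminf (\<lambda>k. ennreal (U k \<omega>))") auto
    have "\<exists>\<^sub>F k in sequentially. U k \<omega> < r + 1"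
    proof (rule ccontr)
      assume "\<not> ?thesis"
      then have "\<forall>\<^sub>F k in sequentially. ennreal (r + 1) \<le> ennreal (U k \<omega>)"
        unfolding not_frequently by eventually_elim (simp add: ennreal_leI)
      then have "ennreal (r + 1) \<le> ennreal r" unfolding r(2)[symmetric] by (rule Liminf_bounded)
      then show False using r(1) by (simp add: ennreal_le_iff)
    qed
    then show ?case using elim by (intro converges_if_no_upcrossings nn) auto
  qed
qed

subsection \<open>Measurability and independence\<close>

text \<open>Approximate the first argument by simple functions \<open>s i\<close>. With finitely
  many values of \<open>s i\<close>, measurability of each section is enough, and continuity in the
  first argument passes to the limit.\<close>

lemma borel_measurable_caratheodory:
  fixes f :: "'a::{metric_space, second_countable_topology} \<Rightarrow> 'b \<Rightarrow> real"
  assumes cont: "\<And>z. z \<in> space N \<Longrightarrow> continuous_on UNIV (\<lambda>x. f x z)"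
    and meas: "\<And>x. f x \<in> borel_measurable N"
  shows "(\<lambda>(x, z). f x z) \<in> borel_measurable (borel \<Otimes>\<^sub>M N)"
proof -
  obtain s where s: "\<And>i. simple_function borel (s i)" "\<And>x::'a. (\<lambda>i. s i x) \<longlonglongrightarrow> x"
    using borel_measurable_implies_sequence_metric[of "\<lambda>x::'a. x" borel undefined] by auto
  show ?thesis
  proof (rule borel_measurable_LIMSEQ_metric[where f = "\<lambda>i (x, z). f (s i x) z"])
    fix i
    have fin: "finite (range (s i))" using s(1)[of i] by (simp add: simple_function_def)
    have "(\<lambda>p. f (s i (fst p)) (snd p)) \<in> borel_measurable (borel \<Otimes>\<^sub>M N)"
    proof (rule measurable_compose_countable'[where I = "range (s i)" and f = "\<lambda>y p. f y (snd p)"])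
      show "(\<lambda>p. f y (snd p)) \<in> borel_measurable (borel \<Otimes>\<^sub>M N)" for y using meas[of y] by measurable
      have "s i \<in> measurable borel (count_space (range (s i)))"
        using measurable_simple_function[OF s(1)[of i]] fin
        by (auto simp: measurable_def)
      then show "(\<lambda>p. s i (fst p)) \<in> measurable (borel \<Otimes>\<^sub>M N) (count_space (range (s i)))"
        by measurable
    qed (use fin in \<open>simp add: countable_finite\<close>)
    then show "(\<lambda>(x, z). f (s i x) z) \<in> borel_measurable (borel \<Otimes>\<^sub>M N)" by (simp add: split_beta')
  next
    fix p assume "p \<in> space (borel \<Otimes>\<^sub>M N :: ('a \<times> 'b) measure)"
    then have z: "snd p \<in> space N" by (auto simp: space_pair_measure)
    have "isCont (\<lambda>x. f x (snd p)) (fst p)" using cont[OF z] by (simp add: continuous_on_eq_continuous_at)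
    then have "(\<lambda>i. f (s i (fst p)) (snd p)) \<longlonglongrightarrow> f (fst p) (snd p)"
      using s(2) by (rule isCont_tendsto_compose)
    then show "(\<lambda>i. (case p of (x, z) \<Rightarrow> f (s i x) z)) \<longlonglongrightarrow> (case p of (x, z) \<Rightarrow> f x z)"
      by (simp add: split_beta)
  qed
qed

text \<open>Independence is expressed by the product rule on events, so that \<open>X\<close> can
  later be the identity map into the sigma-algebra of the past.\<close>

lemma (in prob_space) distr_pair_eq_pair_measure:
  assumes X [measurable]: "X \<in> measurable M S" and Y [measurable]: "Y \<in> measurable M T"
    and indep: "\<And>A B. A \<in> sets S \<Longrightarrow> B \<in> sets T \<Longrightarrow>
      prob ((X -` A \<inter> space M) \<inter> (Y -` B \<inter> space M)) = prob (X -` A \<inter> space M) * prob (Y -` B \<inter> space M)"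
  shows "distr M S X \<Otimes>\<^sub>M distr M T Y = distr M (S \<Otimes>\<^sub>M T) (\<lambda>\<omega>. (X \<omega>, Y \<omega>))"
proof (rule pair_measure_eqI)
  show "sigma_finite_measure (distr M S X)" "sigma_finite_measure (distr M T Y)"
    by (intro prob_space_imp_sigma_finite prob_space_distr X Y)+
  show "sets (distr M S X \<Otimes>\<^sub>M distr M T Y) = sets (distr M (S \<Otimes>\<^sub>M T) (\<lambda>\<omega>. (X \<omega>, Y \<omega>)))"
    by (simp cong: sets_pair_measure_cong)
  fix A B assume "A \<in> sets (distr M S X)" "B \<in> sets (distr M T Y)"
  then have AB [measurable]: "A \<in> sets S" "B \<in> sets T" by auto
  have "(\<lambda>\<omega>. (X \<omega>, Y \<omega>)) -` (A \<times> B) \<inter> space M = (X -` A \<inter> space M) \<inter> (Y -` B \<inter> space M)"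
    by auto
  then show "emeasure (distr M S X) A * emeasure (distr M T Y) B
      = emeasure (distr M (S \<Otimes>\<^sub>M T) (\<lambda>\<omega>. (X \<omega>, Y \<omega>))) (A \<times> B)"
    using indep[OF AB] by (simp add: emeasure_distr emeasure_eq_measure ennreal_mult'')
qed

subsection \<open>Smooth convex stochastic objectives\<close>

text \<open>This gives differentiability of an expectation without differentiating under the
  integral sign: a quadratic remainder bound survives integration.\<close>

lemma GDERIV_if_quadratic_bound:
  fixes f :: "'a::real_inner \<Rightarrow> real"
  assumes "\<And>y. \<bar>f y - f x - D \<bullet> (y - x)\<bar> \<le> C * (norm (y - x))\<^sup>2"
  shows "GDERIV f x :> D"
  unfolding gderiv_def
proof (rule has_derivativeI_sandwich[where e = 1 and H = "\<lambda>y. C * norm (y - x)"])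
  show "bounded_linear (\<lambda>h. h \<bullet> D)" by (rule bounded_linear_inner_left)
  show "((\<lambda>y. C * norm (y - x)) \<longlongrightarrow> 0) (at x)"
    by (rule tendsto_eq_intros refl | simp)+
  show "norm (f y - f x - (y - x) \<bullet> D) / norm (y - x) \<le> C * norm (y - x)" if "y \<noteq> x" for y
    using assms[of y] that by (simp add: field_simps power2_eq_square inner_commute)
qed simp

section \<open>Orthogonal directions and finite differences\<close>

lemma sum_scaleR_columns_norm:
  fixes p :: "real^'l^'d"
  assumes p: "transpose p ** p = c *\<^sub>R mat 1"
  shows "(norm (\<Sum>i\<in>UNIV. r i *\<^sub>R column i p))\<^sup>2 = c * (\<Sum>i\<in>UNIV. (r i)\<^sup>2)"
proof -
  have col: "column i p \<bullet> column j p = (if i = j then c else 0)" for i j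
  proof -
    have "(transpose p ** p) $ i $ j = column i p \<bullet> column j p"
      by (simp add: matrix_matrix_mult_def transpose_def column_def inner_vec_def)
    then show ?thesis by (cases "i = j") (simp_all add: p mat_def)
  qed
  have "(norm (\<Sum>i\<in>UNIV. r i *\<^sub>R column i p))\<^sup>2
      = (\<Sum>i\<in>UNIV. r i * (\<Sum>j\<in>UNIV. r j * (column j p \<bullet> column i p)))"
    by (simp add: power2_norm_eq_inner inner_sum_left inner_sum_right inner_commute sum_distrib_left mult_ac)
  also have "\<dots> = (\<Sum>i\<in>UNIV. r i * (r i * c))"
    by (intro sum.cong refl) (simp add: col if_distrib[of "\<lambda>x. _ * x"] cong: if_cong)
  also have "\<dots> = c * (\<Sum>i\<in>UNIV. (r i)\<^sup>2)"
    by (simp add: sum_distrib_left power2_eq_square mult_ac)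
  finally show ?thesis .
qed

text \<open>The sum is linear in the matrix \<open>p ** transpose p\<close>, whose mean is the only
  moment of the directions that is prescribed.\<close>

lemma column_inner_eq:
  fixes p :: "real^'l^'d"
  shows "(\<Sum>i\<in>UNIV. (column i p \<bullet> a) * (column i p \<bullet> b)) = ((p ** transpose p) *v a) \<bullet> b"
proof -
  have "transpose p $ i = column i p" for i
    by (simp add: transpose_def column_def vec_eq_iff)
  then have "(transpose p *v a) $ i = column i p \<bullet> a" for i
    by (simp only: matrix_vector_mul_component)
  then have "p *v (transpose p *v a) = (\<Sum>i\<in>UNIV. (column i p \<bullet> a) *\<^sub>R column i p)"
    by (simp only: matrix_mult_sum scalar_mult_eq_scaleR)
  then have "(p ** transpose p) *v a = (\<Sum>i\<in>UNIV. (column i p \<bullet> a) *\<^sub>R column i p)"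
    by (simp only: matrix_vector_mul_assoc)
  then show ?thesis by (simp add: inner_sum_left)
qed

definition szd_direction :: "(real^'d \<Rightarrow> real) \<Rightarrow> real \<Rightarrow> real^'l^'d \<Rightarrow> real^'d \<Rightarrow> real^'d" where
  "szd_direction \<phi> h p y = (\<Sum>i\<in>UNIV. ((\<phi> (y + h *\<^sub>R column i p) - \<phi> y) / h) *\<^sub>R column i p)"

text \<open>The direction splits as \<open>q + e\<close>, with \<open>q\<close> built from exact
  directional derivatives and \<open>e\<close> from the finite-difference errors \<open>r i\<close>.
  Columns have squared norm \<open>c\<close>, so \<open>\<bar>r i\<bar> \<le> L * h * c / 2\<close>,
  and orthogonality bounds \<open>norm e\<close>. The cross term of \<open>e\<close> with
  \<open>v\<close> gives the coefficient of \<open>norm v\<close>. The square is split by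
  \<open>(norm (q + e))\<^sup>2 \<le> 2 * (norm q)\<^sup>2 + 2 * (norm e)\<^sup>2\<close>, the
  origin of the factor 2 in \<open>2 * \<alpha>\<^sup>2 * c\<close> and later in
  \<open>2 * G\<close>.\<close>

lemma szd_step_bound:
  fixes p :: "real^'l^'d" and a v y :: "real^'d" and d l c L :: real
  defines "d \<equiv> real CARD('d)" and "l \<equiv> real CARD('l)"
  defines "c \<equiv> d / l"
  assumes p: "transpose p ** p = c *\<^sub>R mat 1"
    and smooth: "\<And>y'. \<bar>\<phi> y' - \<phi> y - a \<bullet> (y' - y)\<bar> \<le> L / 2 * (norm (y' - y))\<^sup>2"
    and h: "h > 0" and \<alpha>: "\<alpha> > 0" and L: "L > 0"
  shows "(norm (v - \<alpha> *\<^sub>R szd_direction \<phi> h p y))\<^sup>2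
    \<le> (norm v)\<^sup>2 - 2 * \<alpha> * (\<Sum>i\<in>UNIV. (column i p \<bullet> a) * (column i p \<bullet> v))
      + 2 * \<alpha>\<^sup>2 * c * (\<Sum>i\<in>UNIV. (column i p \<bullet> a) * (column i p \<bullet> a))
      + L * d * sqrt d / l * \<alpha> * h * norm v + d / l * (L\<^sup>2 * d\<^sup>2 / (2 * l) * h\<^sup>2) * \<alpha>\<^sup>2"
proof -
  have d0: "d > 0" and l0: "l > 0" by (auto simp: d_def l_def)
  have c0: "c > 0" unfolding c_def using d0 l0 by simp
  define r where "r i = (\<phi> (y + h *\<^sub>R column i p) - \<phi> y) / h - column i p \<bullet> a" for i
  define q where "q = (\<Sum>i\<in>UNIV. (column i p \<bullet> a) *\<^sub>R column i p)"
  define e where "e = (\<Sum>i\<in>UNIV. r i *\<^sub>R column i p)"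
  have dir: "szd_direction \<phi> h p y = q + e"
    unfolding szd_direction_def q_def e_def r_def sum.distrib[symmetric]
    by (simp add: scaleR_left_distrib[symmetric])
  have norm_col: "(norm (column i p))\<^sup>2 = c" for i
    using sum_scaleR_columns_norm[OF p, of "\<lambda>j. if j = i then 1 else 0"]
    by (simp add: if_distrib[of "\<lambda>x. x *\<^sub>R _"] if_distrib[of "\<lambda>x. x ^ 2"] cong: if_cong)
  have r: "\<bar>r i\<bar> \<le> L * h * c / 2" for i
  proof -
    have "\<bar>\<phi> (y + h *\<^sub>R column i p) - \<phi> y - h * (column i p \<bullet> a)\<bar> \<le> L / 2 * (h\<^sup>2 * c)"
      using smooth[of "y + h *\<^sub>R column i p"]
      by (simp add: power_mult_distrib norm_col inner_commute)
    moreover have "\<phi> (y + h *\<^sub>R column i p) - \<phi> y - h * (column i p \<bullet> a) = h * r i"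
      unfolding r_def using h by (simp add: field_simps)
    ultimately have "h * \<bar>r i\<bar> \<le> h * (L * h * c / 2)"
      using h by (simp add: abs_mult power2_eq_square mult_ac)
    then show ?thesis using h by simp
  qed
  have cl: "c * l = d" unfolding c_def using l0 by simp
  have e2: "(norm e)\<^sup>2 \<le> d * (L * h * c / 2)\<^sup>2"
  proof -
    have "(\<Sum>i\<in>UNIV. (r i)\<^sup>2) \<le> (\<Sum>i\<in>(UNIV::'l set). (L * h * c / 2)\<^sup>2)"
      by (intro sum_mono abs_le_square_iff[THEN iffD1]) (use r in \<open>smt (verit)\<close>)
    then have "(\<Sum>i\<in>UNIV. (r i)\<^sup>2) \<le> l * (L * h * c / 2)\<^sup>2"
      by (simp add: l_def)
    then have "c * (\<Sum>i\<in>UNIV. (r i)\<^sup>2) \<le> c * (l * (L * h * c / 2)\<^sup>2)"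
      using c0 by (intro mult_left_mono) auto
    then show ?thesis unfolding e_def sum_scaleR_columns_norm[OF p]
      by (simp add: cl[symmetric] mult_ac)
  qed
  have e1: "norm e \<le> L * d * sqrt d / l * h / 2"
  proof -
    have "norm e \<le> sqrt (d * (L * h * c / 2)\<^sup>2)" using e2 by (rule real_le_rsqrt)
    also have "\<dots> = sqrt d * (L * h * c / 2)"
      using L h c0 d0 by (simp add: real_sqrt_mult)
    finally show ?thesis by (simp add: c_def mult_ac)
  qed
  have "(norm (v - \<alpha> *\<^sub>R (q + e)))\<^sup>2
      = (norm v)\<^sup>2 - 2 * \<alpha> * (q \<bullet> v) - 2 * \<alpha> * (e \<bullet> v) + \<alpha>\<^sup>2 * (norm (q + e))\<^sup>2"
    unfolding power2_norm_eq_inner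
    by (simp add: inner_diff_left inner_diff_right inner_add_left inner_add_right
        inner_commute algebra_simps power2_eq_square)
  also have "\<dots> \<le> (norm v)\<^sup>2 - 2 * \<alpha> * (q \<bullet> v) + L * d * sqrt d / l * \<alpha> * h * norm v
      + \<alpha>\<^sup>2 * (2 * (norm q)\<^sup>2 + 2 * (d * (L * h * c / 2)\<^sup>2))"
  proof -
    have "- (e \<bullet> v) \<le> norm e * norm v"
      using Cauchy_Schwarz_ineq2[of e v] by linarith
    also have "\<dots> \<le> (L * d * sqrt d / l * h / 2) * norm v"
      using e1 by (intro mult_right_mono) auto
    finally have "2 * \<alpha> * (- (e \<bullet> v)) \<le> 2 * \<alpha> * ((L * d * sqrt d / l * h / 2) * norm v)"
      using \<alpha> by (intro mult_left_mono) auto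
    moreover have "(norm (q + e))\<^sup>2 \<le> 2 * (norm q)\<^sup>2 + 2 * (norm e)\<^sup>2"
    proof -
      have "0 \<le> (norm (q - e))\<^sup>2" by simp
      then show ?thesis
        by (simp add: power2_norm_eq_inner inner_diff_left inner_diff_right inner_add_left inner_add_right
            inner_commute)
    qed
    then have "\<alpha>\<^sup>2 * (norm (q + e))\<^sup>2 \<le> \<alpha>\<^sup>2 * (2 * (norm q)\<^sup>2 + 2 * (d * (L * h * c / 2)\<^sup>2))"
      using e2 by (intro mult_left_mono) auto
    ultimately show ?thesis by (simp add: mult_ac)
  qed
  also have "(norm q)\<^sup>2 = c * (\<Sum>i\<in>UNIV. (column i p \<bullet> a) * (column i p \<bullet> a))"
    unfolding q_def sum_scaleR_columns_norm[OF p] by (simp add: power2_eq_square)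
  also have "q \<bullet> v = (\<Sum>i\<in>UNIV. (column i p \<bullet> a) * (column i p \<bullet> v))"
    unfolding q_def by (simp add: inner_sum_left)
  also have "\<alpha>\<^sup>2 * (2 * (c * X) + 2 * (d * (L * h * c / 2)\<^sup>2))
      = 2 * \<alpha>\<^sup>2 * c * X + d / l * (L\<^sup>2 * d\<^sup>2 / (2 * l) * h\<^sup>2) * \<alpha>\<^sup>2" for X
    using l0 unfolding c_def by (simp add: power2_eq_square field_simps)
  finally show ?thesis unfolding dir by simp
qed

text \<open>Each coordinate of the gradient is a pointwise limit of difference quotients with
  increments \<open>inverse (Suc n)\<close>.\<close>

lemma gradient_measurable:
  fixes F :: "'a::euclidean_space \<Rightarrow> 'z \<Rightarrow> real"
  assumes [measurable]: "\<And>y. F y \<in> borel_measurable N"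
    and diff: "\<And>z. z \<in> space N \<Longrightarrow> (\<lambda>x. F x z) differentiable (at x)"
  shows "(\<lambda>z. gradient (\<lambda>x. F x z) x) \<in> borel_measurable N"
proof (subst borel_measurable_euclidean_space, rule ballI)
  fix b :: 'a assume "b \<in> Basis"
  show "(\<lambda>z. gradient (\<lambda>x. F x z) x \<bullet> b) \<in> borel_measurable N"
  proof (rule borel_measurable_LIMSEQ_metric[where
        f = "\<lambda>n z. (F (x + inverse (real (Suc n)) *\<^sub>R b) z - F x z) / inverse (real (Suc n))"])
    fix z assume z: "z \<in> space N"
    have "((\<lambda>t. F (x + t *\<^sub>R b) z) has_real_derivative b \<bullet> gradient (\<lambda>x. F x z) x) (at 0)"
      by (rule GDERIV_line[where f = "\<lambda>x. F x z"]) (simp add: GDERIV_gradient diff z)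
    then have "((\<lambda>t. (F (x + t *\<^sub>R b) z - F x z) / t) \<longlongrightarrow> b \<bullet> gradient (\<lambda>x. F x z) x) (at 0)"
      by (simp add: DERIV_def)
    then show "(\<lambda>n. (F (x + inverse (real (Suc n)) *\<^sub>R b) z - F x z) / inverse (real (Suc n)))
        \<longlonglongrightarrow> gradient (\<lambda>x. F x z) x \<bullet> b"
      using LIMSEQ_inverse_real_of_nat unfolding tendsto_at_iff_sequentially
      by (auto simp: o_def inner_commute)
  qed measurable
qed

section \<open>The objective and its gradient under the law of a sample\<close>

locale stochastic_smooth_convex = prob_space \<mu> for \<mu> :: "'z measure" +
  fixes F :: "'a::euclidean_space \<Rightarrow> 'z \<Rightarrow> real" and lam A B G :: real and f fstar
  assumes f_def: "f = (\<lambda>x. \<integral>z. F x z \<partial>\<mu>)" and fstar_def: "fstar = (INF x. f x)"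
    and F_measurable [measurable]: "\<And>x. F x \<in> borel_measurable \<mu>"
    and lam: "lam > 0"
    and F_differentiable: "\<And>z x. z \<in> space \<mu> \<Longrightarrow> (\<lambda>x. F x z) differentiable (at x)"
    and F_lipschitz: "\<And>z. z \<in> space \<mu> \<Longrightarrow> lam-lipschitz_on UNIV (gradient (\<lambda>x. F x z))"
    and F_integrable: "\<And>x. integrable \<mu> (F x)"
    and argmin_nonempty: "argmin f \<noteq> {}"
    and ABG: "A > 0" "B > 0" "G > 0"
    and gradient_square_integrable: "\<And>x. integrable \<mu> (\<lambda>z. (norm (gradient (\<lambda>x. F x z) x))\<^sup>2)"
    and gradient_square_bound: "\<And>x. (\<integral>z. (norm (gradient (\<lambda>x. F x z) x))\<^sup>2 \<partial>\<mu>)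
           \<le> A * (f x - fstar) + B * (norm (gradient f x))\<^sup>2 + G"
    and F_convex: "\<And>z. z \<in> space \<mu> \<Longrightarrow> convex_on UNIV (\<lambda>y. F y z)"
begin

abbreviation "gradF x z \<equiv> gradient (\<lambda>x. F x z) x"

lemma GDERIV_F: "z \<in> space \<mu> \<Longrightarrow> GDERIV (\<lambda>x. F x z) x :> gradF x z"
  by (intro GDERIV_gradient F_differentiable)

lemma F_quadratic_bound:
  assumes "z \<in> space \<mu>"
  shows "\<bar>F y z - F x z - gradF x z \<bullet> (y - x)\<bar> \<le> lam / 2 * (norm (y - x))\<^sup>2"
  using lipschitz_onD[OF F_lipschitz[OF assms]]
  by (intro lipschitz_gradient_quadratic_bound[where f = "\<lambda>x. F x z"] GDERIV_F assms)
     (simp add: dist_norm)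

lemma gradF_measurable [measurable]: "gradF x \<in> borel_measurable \<mu>"
  by (intro gradient_measurable F_measurable F_differentiable)

lemma gradF_integrable: "integrable \<mu> (gradF x)"
proof (rule Bochner_Integration.integrable_bound)
  show "integrable \<mu> (\<lambda>z. 1 + (norm (gradF x z))\<^sup>2)" using gradient_square_integrable[of x] by simp
  have "t \<le> 1 + t\<^sup>2" if "0 \<le> t" for t :: real
    using zero_le_power2[of "t - 1"] that unfolding power2_diff by simp
  then show "AE z in \<mu>. norm (gradF x z) \<le> norm (1 + (norm (gradF x z))\<^sup>2)" by simp
qed measurable

text \<open>The bound involves the mean sample gradient, since differentiability of \<open>f\<close>
  with this gradient is deduced from it.\<close>

lemma f_quadratic_bound_expectation:
  "\<bar>f y - f x - (\<integral>z. gradF x z \<partial>\<mu>) \<bullet> (y - x)\<bar> \<le> lam / 2 * (norm (y - x))\<^sup>2"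
proof -
  have int: "integrable \<mu> (\<lambda>z. F y z - F x z - gradF x z \<bullet> (y - x))"
    by (intro Bochner_Integration.integrable_diff F_integrable integrable_inner_left gradF_integrable)
  have "f y - f x - (\<integral>z. gradF x z \<partial>\<mu>) \<bullet> (y - x) = (\<integral>z. F y z - F x z - gradF x z \<bullet> (y - x) \<partial>\<mu>)"
    by (simp add: f_def F_integrable gradF_integrable)
  also have "\<bar>\<dots>\<bar> \<le> (\<integral>z. \<bar>F y z - F x z - gradF x z \<bullet> (y - x)\<bar> \<partial>\<mu>)"
    by (rule integral_abs_bound)
  also have "\<dots> \<le> (\<integral>z. lam / 2 * (norm (y - x))\<^sup>2 \<partial>\<mu>)"
    using int by (intro integral_mono F_quadratic_bound) auto
  finally show ?thesis by (simp add: prob_space)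
qed

lemma gradient_f: "gradient f x = (\<integral>z. gradF x z \<partial>\<mu>)"
  by (intro gradient_eqI GDERIV_if_quadratic_bound[where C = "lam / 2"] f_quadratic_bound_expectation)

lemma f_quadratic_bound: "\<bar>f y - f x - gradient f x \<bullet> (y - x)\<bar> \<le> lam / 2 * (norm (y - x))\<^sup>2"
  using f_quadratic_bound_expectation by (simp add: gradient_f)

lemma GDERIV_f: "GDERIV f x :> gradient f x"
  by (intro GDERIV_if_quadratic_bound[where C = "lam / 2"] f_quadratic_bound)

lemma continuous_on_f: "continuous_on UNIV f"
  using GDERIV_f unfolding gderiv_def
  by (meson continuous_at_imp_continuous_on has_derivative_continuous)

lemma convex_on_f: "convex_on UNIV f"
proof (rule convex_onI)
  fix t x y assume t: "0 < t" "(t::real) < 1"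
  have "f ((1 - t) *\<^sub>R x + t *\<^sub>R y) \<le> (\<integral>z. (1 - t) * F x z + t * F y z \<partial>\<mu>)"
    unfolding f_def using t
    by (intro integral_mono F_integrable) (auto intro!: convex_onD[OF F_convex] simp: F_integrable)
  then show "f ((1 - t) *\<^sub>R x + t *\<^sub>R y) \<le> (1 - t) * f x + t * f y"
    by (simp add: f_def F_integrable)
qed simp

lemma f_argmin:
  assumes "xb \<in> argmin f"
  shows "f xb = fstar"
proof -
  have "f xb \<le> f x" for x using assms by (auto simp: argmin_def is_arg_min_def not_less)
  then show ?thesis unfolding fstar_def by (intro antisym cINF_greatest cINF_lower bdd_belowI[of _ "f xb"]) auto
qed

lemma fstar_le: "fstar \<le> f x"
proof -
  obtain xb where xb: "xb \<in> argmin f" using argmin_nonempty by blast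
  then have "f xb \<le> f x" by (auto simp: argmin_def is_arg_min_def not_less)
  then show ?thesis using f_argmin[OF xb] by simp
qed

lemma argmin_f: "argmin f = {x. f x = fstar}"
  using f_argmin fstar_le by (auto simp: argmin_def is_arg_min_def not_less)

text \<open>A gradient step of length \<open>1 / lam\<close> lowers \<open>f\<close> by at least
  \<open>(norm (gradient f x))\<^sup>2 / (2 * lam)\<close> and cannot pass below
  \<open>fstar\<close>. In particular the gradient vanishes at minimizers.\<close>

lemma norm_gradient_f_square_le: "(norm (gradient f x))\<^sup>2 \<le> 2 * lam * (f x - fstar)"
proof -
  let ?g = "gradient f x"
  have "f (x - (1 / lam) *\<^sub>R ?g) \<le> f x - (norm ?g)\<^sup>2 / (2 * lam)"
  proof -
    have "f (x - (1 / lam) *\<^sub>R ?g) \<le> f x - (?g \<bullet> ?g) / lam + lam / 2 * (norm ?g / lam)\<^sup>2"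
      using abs_le_D1[OF f_quadratic_bound[of "x - (1 / lam) *\<^sub>R ?g" x]] lam
      by (simp add: power2_norm_eq_inner)
    then show ?thesis using lam
      unfolding power2_norm_eq_inner[symmetric] by (simp add: power_divide power2_eq_square field_simps)
  qed
  with fstar_le[of "x - (1 / lam) *\<^sub>R ?g"] have "fstar \<le> f x - (norm ?g)\<^sup>2 / (2 * lam)" by linarith
  then show ?thesis using lam by (simp add: field_simps)
qed

text \<open>The test point \<open>?u\<close> moves along the gradient at \<open>x\<close>, but
  starts at the minimizer. There \<open>f\<close> lies below its quadratic bound at
  \<open>xb\<close> and above its tangent at \<open>x\<close>; comparing the two yields the claim,
  and the length \<open>1 / lam\<close> makes the extra gradient term as large as possible.\<close>

lemma gradient_f_inner_ge:
  assumes xb: "xb \<in> argmin f"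
  shows "f x - fstar + (norm (gradient f x))\<^sup>2 / (2 * lam) \<le> gradient f x \<bullet> (x - xb)"
proof -
  let ?g = "gradient f x"
  let ?u = "xb + (1 / lam) *\<^sub>R ?g"
  have "gradient f xb = 0"
    using norm_gradient_f_square_le[of xb] f_argmin[OF xb] by simp
  then have "f ?u \<le> fstar + lam / 2 * (norm ((1 / lam) *\<^sub>R ?g))\<^sup>2"
    using abs_le_D1[OF f_quadratic_bound[of ?u xb]] f_argmin[OF xb] by simp
  also have "lam / 2 * (norm ((1 / lam) *\<^sub>R ?g))\<^sup>2 = (norm ?g)\<^sup>2 / (2 * lam)"
    using lam by (simp add: power_mult_distrib power_divide power2_eq_square)
  finally have "f ?u \<le> fstar + (norm ?g)\<^sup>2 / (2 * lam)" .
  moreover have "f x + ?g \<bullet> (?u - x) \<le> f ?u"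
    by (rule convex_on_gradient_ineq[OF convex_on_f GDERIV_f])
  moreover have "?g \<bullet> (?u - x) = (norm ?g)\<^sup>2 / lam - ?g \<bullet> (x - xb)"
    by (simp add: inner_diff_right inner_add_right power2_norm_eq_inner)
  moreover have "(norm ?g)\<^sup>2 / lam = 2 * ((norm ?g)\<^sup>2 / (2 * lam))" by simp
  ultimately show ?thesis by linarith
qed

text \<open>Transfers integrability from the squared distance to the objective gap.\<close>

lemma f_gap_le:
  assumes xb: "xb \<in> argmin f"
  shows "f y - fstar \<le> lam / 2 * (norm (y - xb))\<^sup>2"
proof -
  have "gradient f xb = 0"
    using norm_gradient_f_square_le[of xb] f_argmin[OF xb] by simp
  then show ?thesis using abs_le_D1[OF f_quadratic_bound[of y xb]] f_argmin[OF xb] by simp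
qed

text \<open>Here \<open>s\<close> will be \<open>\<alpha> * (d / l)\<close>. In terms of
  \<open>q\<close>, the inner product supplies \<open>D + q\<close>, while the \<open>B\<close> term
  of the variance bound costs \<open>2 * (s * lam * B) * q\<close>.\<close>

lemma descent_bound:
  assumes xb: "xb \<in> argmin f" and s: "0 \<le> s" and \<delta>: "\<delta> \<le> 1 - s * (A + lam * B)" and \<delta>0: "0 < \<delta>"
  shows "\<delta> * (f x - fstar) + s * (\<integral>z. (norm (gradF x z))\<^sup>2 \<partial>\<mu>)
    \<le> gradient f x \<bullet> (x - xb) + s * G"
proof -
  define D where "D = f x - fstar"
  define q where "q = (norm (gradient f x))\<^sup>2 / (2 * lam)"
  have D0: "0 \<le> D" unfolding D_def using fstar_le by simp
  have q: "0 \<le> q" "q \<le> D"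
    using norm_gradient_f_square_le[of x] lam unfolding q_def D_def by (auto simp: field_simps)
  have "s * (\<integral>z. (norm (gradF x z))\<^sup>2 \<partial>\<mu>) \<le> s * (A * D + B * (norm (gradient f x))\<^sup>2 + G)"
    unfolding D_def using s by (intro mult_left_mono gradient_square_bound)
  moreover have "(norm (gradient f x))\<^sup>2 = 2 * lam * q" unfolding q_def using lam by simp
  ultimately have 1: "s * (\<integral>z. (norm (gradF x z))\<^sup>2 \<partial>\<mu>) \<le> s * A * D + 2 * (s * lam * B) * q + s * G"
    by (simp add: algebra_simps)
  \<comment> \<open>The claim is affine in \<open>q\<close>, so only \<open>q = 0\<close> and \<open>q = D\<close> matter.\<close>
  define t where "t = s * lam * B"
  have t: "0 \<le> t" unfolding t_def using s lam ABG by simp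
  have sA: "0 \<le> s * A" using s ABG by simp
  have t1: "t \<le> 1" using \<delta> \<delta>0 sA unfolding t_def by (simp add: algebra_simps)
  have "\<delta> * D + s * A * D + t * D \<le> D"
    using mult_right_mono[OF \<delta> D0] unfolding t_def by (simp add: algebra_simps)
  moreover have "2 * t * q \<le> t * D + q"
  proof -
    have "t * q \<le> t * D" using q t by (intro mult_left_mono) auto
    moreover have "t * q \<le> 1 * q" using q t1 by (intro mult_right_mono) auto
    ultimately show ?thesis by simp
  qed
  ultimately have "\<delta> * D + s * A * D + 2 * t * q \<le> D + q" by simp
  then show ?thesis using 1 gradient_f_inner_ge[OF xb, of x] unfolding D_def[symmetric] q_def[symmetric] t_def
    by linarith
qed

end

subsection \<open>One step of the iteration\<close>

locale szd_step = stochastic_smooth_convex \<mu> F lam A B G f fstar + dir: prob_space \<nu>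
  for \<mu> :: "'z measure" and F :: "real^'d \<Rightarrow> 'z \<Rightarrow> real" and lam A B G f fstar
    and \<nu> :: "(real^'l^'d) measure" +
  fixes d l :: real
  assumes d_def: "d = real CARD('d)" and l_def: "l = real CARD('l)"
    and sets_dir [measurable_cong]: "sets \<nu> = sets borel"
    and dir_mean: "(\<integral>p. p ** transpose p \<partial>\<nu>) = mat 1"
    and dir_orth: "AE p in \<nu>. transpose p ** p = (d / l) *\<^sub>R mat 1"
begin

lemma dl_pos: "d > 0" "l > 0" by (auto simp: d_def l_def)

lemma column_inner_integral:
  shows column_inner_integrable: "integrable \<nu> (\<lambda>p. \<Sum>i\<in>UNIV. (column i p \<bullet> a) * (column i p \<bullet> b))"
    and column_inner_expectation: "(\<integral>p. (\<Sum>i\<in>UNIV. (column i p \<bullet> a) * (column i p \<bullet> b)) \<partial>\<nu>) = a \<bullet> b"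
proof -
  \<comment> \<open>A non-integrable function would have integral 0, whereas the prescribed mean is
    the nonzero identity matrix.\<close>
  have int: "integrable \<nu> (\<lambda>p. p ** transpose p)"
  proof (rule ccontr)
    assume "\<not> ?thesis"
    then have "(mat 1 :: real^'d^'d) = 0" using dir_mean by (simp add: not_integrable_integral_eq)
    then have "(mat 1 :: real^'d^'d) $ undefined $ undefined = 0" by simp
    then show False by (simp add: mat_def)
  qed
  have "linear (\<lambda>Q::real^'d^'d. (Q *v a) \<bullet> b)"
    by (rule linearI)
       (simp_all add: matrix_vector_mult_add_rdistrib inner_add_left scaleR_matrix_vector_assoc[symmetric])
  then have T: "bounded_linear (\<lambda>Q::real^'d^'d. (Q *v a) \<bullet> b)" by (simp add: linear_conv_bounded_linear)
  show "integrable \<nu> (\<lambda>p. \<Sum>i\<in>UNIV. (column i p \<bullet> a) * (column i p \<bullet> b))"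
    unfolding column_inner_eq by (rule integrable_bounded_linear[OF T int])
  show "(\<integral>p. (\<Sum>i\<in>UNIV. (column i p \<bullet> a) * (column i p \<bullet> b)) \<partial>\<nu>) = a \<bullet> b"
    unfolding column_inner_eq using integral_bounded_linear[OF T int] by (simp add: dir_mean)
qed

text \<open>Averaging over \<open>p\<close> with \<open>z\<close> fixed replaces the column sums by
  inner products with the sample gradient; averaging over \<open>z\<close> then brings in
  \<open>gradient f\<close> and the variance bound. Dividing by \<open>2 * \<alpha>\<close> leaves
  exactly \<open>descent_bound\<close>.\<close>

lemma szd_step_expectation:
  assumes xb: "xb \<in> argmin f" and h: "h > 0" and \<alpha>: "\<alpha> > 0"
    and \<delta>0: "0 < \<delta>" and \<delta>: "\<delta> \<le> 1 - \<alpha> * (d / l) * (A + lam * B)"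
  shows "(\<integral>\<^sup>+z. \<integral>\<^sup>+p. ennreal ((norm (y - \<alpha> *\<^sub>R szd_direction (\<lambda>x. F x z) h p y - xb))\<^sup>2) \<partial>\<nu> \<partial>\<mu>)
      + ennreal (2 * \<alpha> * \<delta> * (f y - fstar))
    \<le> ennreal ((norm (y - xb))\<^sup>2 + lam * d * sqrt d / l * \<alpha> * h * norm (y - xb)
        + d / l * (lam\<^sup>2 * d\<^sup>2 / (2 * l) * h\<^sup>2 + 2 * G) * \<alpha>\<^sup>2)"
proof -
  define v where "v = y - xb"
  define c where "c = d / l"
  define K where "K = lam * d * sqrt d / l * \<alpha> * h * norm v + d / l * (lam\<^sup>2 * d\<^sup>2 / (2 * l) * h\<^sup>2) * \<alpha>\<^sup>2"
  define col where "col a b p = (\<Sum>i\<in>UNIV. (column i p \<bullet> a) * (column i p \<bullet> b))" for a b :: "real^'d" and p :: "real^'l^'d"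
  define R where "R z p = (norm v)\<^sup>2 - 2 * \<alpha> * col (gradF y z) v p
      + 2 * \<alpha>\<^sup>2 * c * col (gradF y z) (gradF y z) p + K" for z p
  define R' where "R' z = (norm v)\<^sup>2 - 2 * \<alpha> * (gradF y z \<bullet> v) + 2 * \<alpha>\<^sup>2 * c * (norm (gradF y z))\<^sup>2 + K" for z
  let ?step = "\<lambda>z p. (norm (y - \<alpha> *\<^sub>R szd_direction (\<lambda>x. F x z) h p y - xb))\<^sup>2"
  have inner: "(\<integral>\<^sup>+p. ennreal (?step z p) \<partial>\<nu>) \<le> ennreal (R' z)" and R'_nn: "0 \<le> R' z"
    if z: "z \<in> space \<mu>" for z
  proof -
    have le: "AE p in \<nu>. ?step z p \<le> R z p"
      using dir_orth
    proof eventually_elim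
      case (elim p)
      have "(norm (v - \<alpha> *\<^sub>R szd_direction (\<lambda>x. F x z) h p y))\<^sup>2 \<le> R z p"
        using szd_step_bound[OF elim[unfolded d_def l_def], of "\<lambda>x. F x z" y "gradF y z" lam h \<alpha> v]
          F_quadratic_bound[OF z] h \<alpha> lam
        by (simp add: R_def col_def c_def K_def d_def l_def)
      then show ?case by (simp add: v_def algebra_simps)
    qed
    \<comment> \<open>\<open>R z p\<close> dominates a square almost everywhere; this sign permits
      passing from the nonnegative integral to the Bochner integral.\<close>
    then have nn: "AE p in \<nu>. 0 \<le> R z p"
      by eventually_elim (metis order_trans zero_le_power2)
    have int: "integrable \<nu> (R z)" unfolding R_def col_def
      by (intro Bochner_Integration.integrable_add Bochner_Integration.integrable_diff
          integrable_mult_right column_inner_integrable dir.integrable_const)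
    have E: "(\<integral>p. R z p \<partial>\<nu>) = R' z"
      unfolding R_def col_def R'_def
      by (simp add: column_inner_integrable column_inner_expectation dir.prob_space power2_norm_eq_inner)
    have "(\<integral>\<^sup>+p. ennreal (?step z p) \<partial>\<nu>) \<le> (\<integral>\<^sup>+p. ennreal (R z p) \<partial>\<nu>)"
      using le by (intro nn_integral_mono_AE) (auto intro: ennreal_leI)
    also have "\<dots> = ennreal (R' z)"
      unfolding E[symmetric] by (rule nn_integral_eq_integral[OF int nn])
    finally show "(\<integral>\<^sup>+p. ennreal (?step z p) \<partial>\<nu>) \<le> ennreal (R' z)" .
    show "0 \<le> R' z" unfolding E[symmetric] using nn by (rule integral_nonneg_AE)
  qed
  have int': "integrable \<mu> R'" unfolding R'_def
    by (intro Bochner_Integration.integrable_add Bochner_Integration.integrable_diff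
          integrable_mult_right integrable_inner_left gradF_integrable gradient_square_integrable integrable_const)
  have E': "(\<integral>z. R' z \<partial>\<mu>) = (norm v)\<^sup>2 - 2 * \<alpha> * (gradient f y \<bullet> v)
      + 2 * \<alpha>\<^sup>2 * c * (\<integral>z. (norm (gradF y z))\<^sup>2 \<partial>\<mu>) + K"
    unfolding R'_def gradient_f
    by (simp add: gradF_integrable gradient_square_integrable prob_space)
  have "(\<integral>\<^sup>+z. \<integral>\<^sup>+p. ennreal (?step z p) \<partial>\<nu> \<partial>\<mu>) \<le> (\<integral>\<^sup>+z. ennreal (R' z) \<partial>\<mu>)"
    by (intro nn_integral_mono inner)
  also have "\<dots> = ennreal (\<integral>z. R' z \<partial>\<mu>)"
    by (rule nn_integral_eq_integral[OF int']) (simp add: R'_nn)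
  finally have "(\<integral>\<^sup>+z. \<integral>\<^sup>+p. ennreal (?step z p) \<partial>\<nu> \<partial>\<mu>) + ennreal (2 * \<alpha> * \<delta> * (f y - fstar))
      \<le> ennreal (\<integral>z. R' z \<partial>\<mu>) + ennreal (2 * \<alpha> * \<delta> * (f y - fstar))"
    by (rule add_right_mono)
  also have "\<dots> = ennreal ((\<integral>z. R' z \<partial>\<mu>) + 2 * \<alpha> * \<delta> * (f y - fstar))"
    using \<alpha> \<delta>0 fstar_le[of y] by (intro ennreal_plus[symmetric] integral_nonneg_AE) (auto simp: R'_nn)
  also have "(\<integral>z. R' z \<partial>\<mu>) + 2 * \<alpha> * \<delta> * (f y - fstar) \<le> (norm v)\<^sup>2 + K + 2 * \<alpha>\<^sup>2 * c * G"
  proof -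
    have "\<delta> * (f y - fstar) + \<alpha> * c * (\<integral>z. (norm (gradF y z))\<^sup>2 \<partial>\<mu>) \<le> gradient f y \<bullet> v + \<alpha> * c * G"
      unfolding v_def using \<delta>0 \<delta> \<alpha> dl_pos by (intro descent_bound[OF xb]) (auto simp: c_def)
    then have "2 * \<alpha> * (\<delta> * (f y - fstar) + \<alpha> * c * (\<integral>z. (norm (gradF y z))\<^sup>2 \<partial>\<mu>))
        \<le> 2 * \<alpha> * (gradient f y \<bullet> v + \<alpha> * c * G)" using \<alpha> by (intro mult_left_mono) auto
    then show ?thesis unfolding E' by (simp add: algebra_simps power2_eq_square)
  qed
  also have "(norm v)\<^sup>2 + K + 2 * \<alpha>\<^sup>2 * c * G
     = (norm (y - xb))\<^sup>2 + lam * d * sqrt d / l * \<alpha> * h * norm (y - xb)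
        + d / l * (lam\<^sup>2 * d\<^sup>2 / (2 * l) * h\<^sup>2 + 2 * G) * \<alpha>\<^sup>2"
    unfolding K_def c_def v_def by (simp add: algebra_simps)
  finally show ?thesis by (simp add: ennreal_leI)
qed

end

subsection \<open>Fejer-type convergence and summation\<close>

text \<open>An Opial-type argument. Divergence of the step sums forces small gaps along a
  subsequence, boundedness gives a cluster point \<open>y\<close>, and continuity makes
  \<open>y\<close> a minimizer. As \<open>y\<close> need not lie in \<open>D\<close>, distances are
  measured to a nearby \<open>s\<close> in \<open>D\<close>, and the triangle inequality
  concludes.\<close>

lemma converges_to_argmin:
  fixes x :: "nat \<Rightarrow> 'a::euclidean_space" and f :: "'a \<Rightarrow> real"
  assumes f: "continuous_on UNIV f" and ge: "\<And>y. m \<le> f y" and T: "{y. f y = m} \<noteq> {}"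
    and D: "D \<subseteq> {y. f y = m}" "{y. f y = m} \<subseteq> closure D"
    and conv: "\<And>s. s \<in> D \<Longrightarrow> convergent (\<lambda>k. (norm (x k - s))\<^sup>2)"
    and \<alpha>: "\<And>k. 0 < \<alpha> k" "filterlim (\<lambda>n. \<Sum>k<n. \<alpha> k) at_top sequentially"
    and summ: "summable (\<lambda>k. \<alpha> k * (f (x k) - m))"
  obtains y where "f y = m" "x \<longlonglongrightarrow> y"
proof -
  \<comment> \<open>Were all gaps from \<open>n\<close> on at least \<open>inverse (Suc n)\<close>,
    then \<open>\<alpha>\<close> would be dominated by \<open>Suc n\<close> times a summable
    sequence.\<close>
  have small: "\<exists>k\<ge>n. f (x k) - m < inverse (real (Suc n))" for n
  proof (rule ccontr)
    assume "\<not> ?thesis"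
    then have big: "inverse (real (Suc n)) \<le> f (x k) - m" if "n \<le> k" for k using that by force
    have "summable \<alpha>"
    proof (rule summable_comparison_test')
      show "summable (\<lambda>k. real (Suc n) * (\<alpha> k * (f (x k) - m)))" using summ by (rule summable_mult)
      show "norm (\<alpha> k) \<le> real (Suc n) * (\<alpha> k * (f (x k) - m))" if "n \<le> k" for k
      proof -
        have "1 \<le> real (Suc n) * (f (x k) - m)" using big[OF that] by (simp add: field_simps)
        then have "\<alpha> k * 1 \<le> \<alpha> k * (real (Suc n) * (f (x k) - m))"
          using less_imp_le[OF \<alpha>(1)[of k]] by (rule mult_left_mono)
        then show ?thesis using \<alpha>(1)[of k] by (simp add: mult_ac)
      qed
    qed
    then have "(\<lambda>n. \<Sum>k<n. \<alpha> k) \<longlonglongrightarrow> suminf \<alpha>" by (rule summable_LIMSEQ)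
    then show False using \<alpha>(2) not_tendsto_and_filterlim_at_infinity[OF sequentially_bot]
      by (meson filterlim_at_top_imp_at_infinity)
  qed
  then obtain r where r: "\<And>n. n \<le> r n" "\<And>n. f (x (r n)) - m < inverse (real (Suc n))" by metis
  have "D \<noteq> {}" using T D(2) by auto
  then obtain s0 where s0: "s0 \<in> D" by blast
  have "Bseq (\<lambda>k. (norm (x k - s0))\<^sup>2)" using conv[OF s0] by (rule convergent_imp_Bseq)
  then obtain K where K: "\<And>k. (norm (x k - s0))\<^sup>2 \<le> K" unfolding Bseq_def by auto
  have "x (r n) \<in> cball s0 (sqrt K)" for n
    using real_le_rsqrt[OF K] by (simp add: dist_norm norm_minus_commute)
  then obtain y q where q: "strict_mono q" "(\<lambda>n. x (r (q n))) \<longlonglongrightarrow> y"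
    using seq_compactE[OF compact_imp_seq_compact[OF compact_cball[of s0 "sqrt K"]], of "\<lambda>n. x (r n)"]
    unfolding o_def by blast
  have rq_ge: "n \<le> r (q n)" for n using seq_suble[OF q(1), of n] r(1)[of "q n"] by linarith
  \<comment> \<open>\<open>r\<close> need not be monotone; for passing to limits along
    \<open>r (q n)\<close> it is enough that these indices tend to infinity.\<close>
  have rq: "filterlim (\<lambda>n. r (q n)) at_top sequentially"
    by (rule filterlim_at_top_mono[OF filterlim_ident]) (simp add: rq_ge)
  have "(\<lambda>n. f (x (r (q n)))) \<longlonglongrightarrow> f y"
    using continuous_on_tendsto_compose[OF f q(2)] by simp
  moreover have "(\<lambda>n. f (x (r (q n)))) \<longlonglongrightarrow> m"
  proof (rule tendsto_sandwich[where f = "\<lambda>_. m" and h = "\<lambda>n. m + inverse (real (Suc n))"])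
    show "(\<lambda>n. m + inverse (real (Suc n))) \<longlonglongrightarrow> m"
      using tendsto_add[OF tendsto_const LIMSEQ_inverse_real_of_nat, of m] by simp
    have "f (x (r (q n))) \<le> m + inverse (real (Suc n))" for n
    proof -
      have "inverse (real (Suc (q n))) \<le> inverse (real (Suc n))"
        using seq_suble[OF q(1), of n] by (intro le_imp_inverse_le) auto
      then show ?thesis using r(2)[of "q n"] by linarith
    qed
    then show "\<forall>\<^sub>F n in sequentially. f (x (r (q n))) \<le> m + inverse (real (Suc n))" by simp
  qed (use ge in auto)
  ultimately have y: "f y = m" by (rule LIMSEQ_unique)
  have "x \<longlonglongrightarrow> y"
  proof (rule metric_LIMSEQ_I)
    fix e :: real assume e: "0 < e"
    have "y \<in> closure D" using y D(2) by blast
    moreover have "0 < e / 2" using e by simp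
    ultimately obtain s where s: "s \<in> D" "dist s y < e / 2"
      unfolding closure_approachable by blast
    obtain L where L: "(\<lambda>k. (norm (x k - s))\<^sup>2) \<longlonglongrightarrow> L" using conv[OF s(1)] by (auto simp: convergent_def)
    have "(\<lambda>n. (norm (x (r (q n)) - s))\<^sup>2) \<longlonglongrightarrow> L" using filterlim_compose[OF L rq] .
    moreover have "(\<lambda>n. (norm (x (r (q n)) - s))\<^sup>2) \<longlonglongrightarrow> (norm (y - s))\<^sup>2"
      by (intro tendsto_intros q)
    ultimately have "L = (norm (y - s))\<^sup>2" by (rule LIMSEQ_unique)
    also have "\<dots> < (e / 2)\<^sup>2"
      using s(2) by (intro power_strict_mono) (auto simp: dist_norm norm_minus_commute)
    finally have "\<forall>\<^sub>F k in sequentially. (norm (x k - s))\<^sup>2 < (e / 2)\<^sup>2" by (rule order_tendstoD(2)[OF L])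
    then obtain N where N: "\<And>k. k \<ge> N \<Longrightarrow> (norm (x k - s))\<^sup>2 < (e / 2)\<^sup>2"
      unfolding eventually_sequentially by blast
    have "dist (x k) y < e" if "k \<ge> N" for k
    proof -
      have "norm (x k - s) < e / 2" using power2_less_imp_less[OF N[OF that]] e by simp
      then show ?thesis using s(2) dist_triangle[of "x k" y s] by (simp add: dist_norm)
    qed
    then show "\<exists>N. \<forall>k\<ge>N. dist (x k) y < e" by blast
  qed
  with y show ?thesis by (rule that)
qed

section \<open>Sums and moments of random variables, and independence of blocks\<close>

lemma (in prob_space) AE_summable:
  fixes X :: "nat \<Rightarrow> 'a \<Rightarrow> real"
  assumes int: "\<And>k. integrable M (X k)" and nn: "\<And>k \<omega>. 0 \<le> X k \<omega>"
    and summ: "summable (\<lambda>k. \<integral>\<omega>. X k \<omega> \<partial>M)"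
  shows "AE \<omega> in M. summable (\<lambda>k. X k \<omega>)"
proof -
  have [measurable]: "X k \<in> borel_measurable M" for k using int by (rule borel_measurable_integrable)
  have "(\<integral>\<^sup>+\<omega>. (\<Sum>k. ennreal (X k \<omega>)) \<partial>M) = (\<Sum>k. \<integral>\<^sup>+\<omega>. ennreal (X k \<omega>) \<partial>M)"
    by (rule nn_integral_suminf) simp
  also have "\<dots> = (\<Sum>k. ennreal (\<integral>\<omega>. X k \<omega> \<partial>M))"
    by (intro suminf_cong nn_integral_eq_integral int) (simp add: nn)
  also have "\<dots> = ennreal (\<Sum>k. \<integral>\<omega>. X k \<omega> \<partial>M)"
    by (intro suminf_ennreal2 summ) (simp add: nn)
  finally have "(\<integral>\<^sup>+\<omega>. (\<Sum>k. ennreal (X k \<omega>)) \<partial>M) \<noteq> \<infinity>" by simp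
  then have "AE \<omega> in M. (\<Sum>k. ennreal (X k \<omega>)) \<noteq> \<infinity>" by (intro nn_integral_PInf_AE) auto
  then show ?thesis
    by eventually_elim (simp add: nn summable_suminf_not_top)
qed

lemma (in prob_space) expectation_le_sqrt:
  fixes X :: "'a \<Rightarrow> real"
  assumes X: "integrable M X" "integrable M (\<lambda>\<omega>. (X \<omega>)\<^sup>2)"
  shows "(\<integral>\<omega>. X \<omega> \<partial>M) \<le> sqrt (\<integral>\<omega>. (X \<omega>)\<^sup>2 \<partial>M)"
  using variance_positive[of X] variance_eq[OF X] by (intro real_le_rsqrt) simp

lemma Int_stable_vimages: "Int_stable {X -` A \<inter> \<Omega> | A. A \<in> sets S}"
proof (rule Int_stableI)
  fix a b assume "a \<in> {X -` A \<inter> \<Omega> | A. A \<in> sets S}" "b \<in> {X -` A \<inter> \<Omega> | A. A \<in> sets S}"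
  then obtain A B where "A \<in> sets S" "B \<in> sets S" "a = X -` A \<inter> \<Omega>" "b = X -` B \<inter> \<Omega>" by blast
  then have "a \<inter> b = X -` (A \<inter> B) \<inter> \<Omega>" "A \<inter> B \<in> sets S" by auto
  then show "a \<inter> b \<in> {X -` A \<inter> \<Omega> | A. A \<in> sets S}" by blast
qed

text \<open>Events of single variables form intersection-stable families, so their independence
  extends to the sigma-algebras generated by disjoint blocks of indices. The blocks will be the past
  and the current step.\<close>

lemma (in prob_space) mutually_indep_generated:
  assumes indep: "mutually_indep X S Y T" and disj: "I \<inter> J = {}"
  defines "E \<equiv> case_sum (\<lambda>k. {X k -` A \<inter> space M | A. A \<in> sets S}) (\<lambda>k. {Y k -` A \<inter> space M | A. A \<in> sets T})"
  assumes A: "A \<in> sigma_sets (space M) (\<Union>i\<in>I. E i)" and B: "B \<in> sigma_sets (space M) (\<Union>i\<in>J. E i)"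
  shows "prob (A \<inter> B) = prob A * prob B"
proof -
  have "indep_sets (\<lambda>b. sigma_sets (space M) (\<Union>i\<in>case_bool I J b. E i)) UNIV"
  proof (rule indep_sets_collect_sigma)
    have "indep_sets E UNIV" using indep unfolding mutually_indep_def E_def by blast
    then show "indep_sets E (\<Union>j\<in>UNIV. case_bool I J j)" by (rule indep_sets_mono_index[rotated]) simp
    show "disjoint_family_on (case_bool I J) UNIV"
      using disj by (auto simp: disjoint_family_on_def split: bool.splits)
    show "Int_stable (E i)" for i
      by (cases i) (simp_all add: E_def Int_stable_vimages)
  qed
  then have "indep_set (sigma_sets (space M) (\<Union>i\<in>I. E i)) (sigma_sets (space M) (\<Union>i\<in>J. E i))"
    unfolding indep_set_def by (rule back_subst[where P = "\<lambda>F. indep_sets F UNIV"]) (auto split: bool.splits)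
  then show ?thesis using A B by (rule indep_setD)
qed

subsection \<open>The iteration as a process adapted to its past\<close>

locale sszd_process = stochastic_smooth_convex \<mu> F lam A B G f fstar + M: prob_space M
  for \<mu> :: "'z measure" and F :: "real^'d \<Rightarrow> 'z \<Rightarrow> real" and lam A B G f fstar and M :: "'w measure" +
  fixes P :: "nat \<Rightarrow> 'w \<Rightarrow> real^'l^'d" and Zs :: "nat \<Rightarrow> 'w \<Rightarrow> 'z"
    and \<alpha> h :: "nat \<Rightarrow> real" and x0 :: "real^'d" and d l \<alpha>bar :: real
  assumes szd_step: "\<And>k. szd_step \<mu> F lam A B G f fstar (distr M borel (P k)) d l"
    and indep: "M.mutually_indep P borel Zs \<mu>"
    and Zs_distr: "\<And>k. distr M \<mu> (Zs k) = \<mu>"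
    and summability: "summability \<alpha> h"
    and \<alpha>bar_bound: "\<alpha>bar * d * (A + lam * B) / l < 1"
    and \<alpha>_le: "\<And>k. \<alpha> k \<le> \<alpha>bar"
begin

definition x :: "nat \<Rightarrow> 'w \<Rightarrow> real^'d" where
  "x k \<omega> = sszd F \<alpha> h (\<lambda>j. P j \<omega>) (\<lambda>j. Zs j \<omega>) x0 k"

text \<open>\<open>Inl\<close> tags directions and \<open>Inr\<close> tags samples, so that one
  index set describes any joint block of both sequences.\<close>

definition generators :: "nat + nat \<Rightarrow> 'w set set" where
  "generators = case_sum (\<lambda>k. {P k -` A \<inter> space M | A. A \<in> sets borel}) (\<lambda>k. {Zs k -` A \<inter> space M | A. A \<in> sets \<mu>})"

definition gen_algebra :: "(nat + nat) set \<Rightarrow> 'w measure" where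
  "gen_algebra I = sigma (space M) (\<Union>i\<in>I. generators i)"

text \<open>Strict bounds on the indices: the iterate \<open>x k\<close> uses only steps before
  \<open>k\<close>, and the pair used at step \<open>k\<close> stays independent of
  \<open>past k\<close>.\<close>

definition past :: "nat \<Rightarrow> 'w measure" where
  "past k = gen_algebra (Inl ` {..<k} \<union> Inr ` {..<k})"

definition \<rho> where "\<rho> k = lam * d * sqrt d / l * \<alpha> k * h k"
definition W where "W k = d / l * (lam\<^sup>2 * d\<^sup>2 / (2 * l) * (h k)\<^sup>2 + 2 * G) * (\<alpha> k)\<^sup>2"

lemma P_measurable [measurable]: "P k \<in> borel_measurable M"
  and Zs_measurable [measurable]: "Zs k \<in> measurable M \<mu>"
  using indep unfolding M.mutually_indep_def by auto

lemma generators_subset: "(\<Union>i\<in>I. generators i) \<subseteq> Pow (space M)"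
  by (auto simp: generators_def split: sum.splits)

lemma space_gen_algebra [simp]: "space (gen_algebra I) = space M"
  unfolding gen_algebra_def using generators_subset by (rule space_measure_of)

lemma sets_gen_algebra: "sets (gen_algebra I) = sigma_sets (space M) (\<Union>i\<in>I. generators i)"
  unfolding gen_algebra_def using generators_subset by (rule sets_measure_of)

lemma generators_sets_M: "generators i \<subseteq> sets M"
  using measurable_sets[OF P_measurable] measurable_sets[OF Zs_measurable]
  by (auto simp: generators_def split: sum.splits)

lemma gen_algebra_mono: "I \<subseteq> J \<Longrightarrow> subalgebra (gen_algebra J) (gen_algebra I)"
  unfolding subalgebra_def sets_gen_algebra by (auto intro!: sigma_sets_mono')

lemma gen_algebra_subalgebra: "subalgebra M (gen_algebra I)"
  unfolding subalgebra_def sets_gen_algebra using generators_sets_M by (auto intro!: sets.sigma_sets_subset)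

lemma P_measurable_gen_algebra: "Inl k \<in> I \<Longrightarrow> P k \<in> borel_measurable (gen_algebra I)"
proof (rule measurableI)
  fix A :: "(real^'l^'d) set" assume "A \<in> sets borel" "Inl k \<in> I"
  then have "P k -` A \<inter> space M \<in> (\<Union>i\<in>I. generators i)" by (force simp: generators_def)
  then show "P k -` A \<inter> space (gen_algebra I) \<in> sets (gen_algebra I)" unfolding sets_gen_algebra by auto
qed simp

lemma Zs_measurable_gen_algebra: "Inr k \<in> I \<Longrightarrow> Zs k \<in> measurable (gen_algebra I) \<mu>"
proof (rule measurableI)
  fix A assume "A \<in> sets \<mu>" "Inr k \<in> I"
  then have "Zs k -` A \<inter> space M \<in> (\<Union>i\<in>I. generators i)" by (force simp: generators_def)
  then show "Zs k -` A \<inter> space (gen_algebra I) \<in> sets (gen_algebra I)" unfolding sets_gen_algebra by auto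
qed (use measurable_space[OF Zs_measurable] in simp)

lemma gen_algebra_indep:
  assumes "I \<inter> J = {}" "U \<in> sets (gen_algebra I)" "V \<in> sets (gen_algebra J)"
  shows "M.prob (U \<inter> V) = M.prob U * M.prob V"
  using assms(2,3) unfolding sets_gen_algebra generators_def
  by (rule M.mutually_indep_generated[OF indep assms(1)])

lemma distr_Zs_P: "\<mu> \<Otimes>\<^sub>M distr M borel (P k) = distr M (\<mu> \<Otimes>\<^sub>M borel) (\<lambda>\<omega>. (Zs k \<omega>, P k \<omega>))"
proof -
  have "distr M \<mu> (Zs k) \<Otimes>\<^sub>M distr M borel (P k) = distr M (\<mu> \<Otimes>\<^sub>M borel) (\<lambda>\<omega>. (Zs k \<omega>, P k \<omega>))"
  proof (rule M.distr_pair_eq_pair_measure[OF Zs_measurable P_measurable])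
    fix A and B :: "(real^'l^'d) set" assume "A \<in> sets \<mu>" "B \<in> sets borel"
    then show "M.prob (Zs k -` A \<inter> space M \<inter> (P k -` B \<inter> space M))
        = M.prob (Zs k -` A \<inter> space M) * M.prob (P k -` B \<inter> space M)"
      using measurable_sets[OF Zs_measurable_gen_algebra[of k "{Inr k}"], of A]
        measurable_sets[OF P_measurable_gen_algebra[of k "{Inl k}"], of B]
      by (intro gen_algebra_indep[of "{Inr k}" "{Inl k}"]) auto
  qed
  then show ?thesis by (simp add: Zs_distr)
qed

lemma past_sets_subset: "sets (past k) \<subseteq> sets M"
  using gen_algebra_subalgebra unfolding past_def subalgebra_def by blast

text \<open>This Fubini formula plays the role of conditioning on the past.\<close>

lemma nn_integral_past:
  assumes \<phi> [measurable]: "\<phi> \<in> borel_measurable (past k \<Otimes>\<^sub>M (\<mu> \<Otimes>\<^sub>M borel))"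
  shows "(\<integral>\<^sup>+\<omega>. \<phi> (\<omega>, (Zs k \<omega>, P k \<omega>)) \<partial>M)
    = (\<integral>\<^sup>+\<omega>. \<integral>\<^sup>+z. \<integral>\<^sup>+p. \<phi> (\<omega>, (z, p)) \<partial>distr M borel (P k) \<partial>\<mu> \<partial>M)"
proof -
  let ?J = "{Inl k, Inr k} :: (nat + nat) set"
  let ?\<nu> = "distr M borel (P k)"
  interpret dir: prob_space ?\<nu> by (rule M.prob_space_distr) simp
  interpret pair: pair_prob_space \<mu> ?\<nu> ..
  have id [measurable]: "(\<lambda>\<omega>. \<omega>) \<in> measurable M (past k)"
  proof (rule measurableI)
    fix U assume "U \<in> sets (past k)"
    then have "U \<in> sets M" using past_sets_subset by blast
    then show "(\<lambda>\<omega>. \<omega>) -` U \<inter> space M \<in> sets M" by simp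
  qed (simp add: past_def)
  have ZP: "(\<lambda>\<omega>. (Zs k \<omega>, P k \<omega>)) \<in> measurable (gen_algebra ?J) (\<mu> \<Otimes>\<^sub>M borel)"
    by (intro measurable_Pair Zs_measurable_gen_algebra P_measurable_gen_algebra) auto
  \<comment> \<open>The past enters as a random variable, namely the identity viewed as a map into
    the coarser space \<open>past k\<close>. Its joint law with the current pair is a product, and
    Tonelli applies.\<close>
  have joint: "distr M (past k) (\<lambda>\<omega>. \<omega>) \<Otimes>\<^sub>M distr M (\<mu> \<Otimes>\<^sub>M borel) (\<lambda>\<omega>. (Zs k \<omega>, P k \<omega>))
      = distr M (past k \<Otimes>\<^sub>M (\<mu> \<Otimes>\<^sub>M borel)) (\<lambda>\<omega>. (\<omega>, (Zs k \<omega>, P k \<omega>)))"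
  proof (rule M.distr_pair_eq_pair_measure[OF id])
    fix A B assume A: "A \<in> sets (past k)" and B: "B \<in> sets (\<mu> \<Otimes>\<^sub>M (borel :: (real^'l^'d) measure))"
    have "A \<subseteq> space M" using sets.sets_into_space[OF A] by (simp add: past_def)
    then have "(\<lambda>\<omega>. \<omega>) -` A \<inter> space M = A" by auto
    then show "M.prob ((\<lambda>\<omega>. \<omega>) -` A \<inter> space M \<inter> ((\<lambda>\<omega>. (Zs k \<omega>, P k \<omega>)) -` B \<inter> space M))
        = M.prob ((\<lambda>\<omega>. \<omega>) -` A \<inter> space M) * M.prob ((\<lambda>\<omega>. (Zs k \<omega>, P k \<omega>)) -` B \<inter> space M)"
      using A measurable_sets[OF ZP B] unfolding past_def
      by (intro gen_algebra_indep[of "Inl ` {..<k} \<union> Inr ` {..<k}" ?J]) auto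
  qed measurable
  have sets_pair [measurable_cong]: "sets (\<mu> \<Otimes>\<^sub>M ?\<nu>) = sets (\<mu> \<Otimes>\<^sub>M borel)"
    by (rule sets_pair_measure_cong) auto
  have "(\<integral>\<^sup>+\<omega>. \<phi> (\<omega>, (Zs k \<omega>, P k \<omega>)) \<partial>M)
      = (\<integral>\<^sup>+w. \<phi> w \<partial>(distr M (past k) (\<lambda>\<omega>. \<omega>) \<Otimes>\<^sub>M (\<mu> \<Otimes>\<^sub>M ?\<nu>)))"
    unfolding distr_Zs_P joint by (subst nn_integral_distr) auto
  also have "\<dots> = (\<integral>\<^sup>+\<omega>. \<integral>\<^sup>+w. \<phi> (\<omega>, w) \<partial>(\<mu> \<Otimes>\<^sub>M ?\<nu>) \<partial>distr M (past k) (\<lambda>\<omega>. \<omega>))"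
    by (rule pair.nn_integral_fst[symmetric]) measurable
  also have "\<dots> = (\<integral>\<^sup>+\<omega>. \<integral>\<^sup>+w. \<phi> (\<omega>, w) \<partial>(\<mu> \<Otimes>\<^sub>M ?\<nu>) \<partial>M)"
    by (rule nn_integral_distr) measurable
  also have "\<dots> = (\<integral>\<^sup>+\<omega>. \<integral>\<^sup>+z. \<integral>\<^sup>+p. \<phi> (\<omega>, (z, p)) \<partial>?\<nu> \<partial>\<mu> \<partial>M)"
  proof (rule nn_integral_cong)
    fix \<omega> assume "\<omega> \<in> space M"
    then have [measurable]: "(\<lambda>w. \<phi> (\<omega>, w)) \<in> borel_measurable (\<mu> \<Otimes>\<^sub>M borel)"
      by (intro measurable_compose[OF measurable_Pair1' \<phi>]) (simp add: past_def)
    show "(\<integral>\<^sup>+w. \<phi> (\<omega>, w) \<partial>(\<mu> \<Otimes>\<^sub>M ?\<nu>)) = (\<integral>\<^sup>+z. \<integral>\<^sup>+p. \<phi> (\<omega>, (z, p)) \<partial>?\<nu> \<partial>\<mu>)"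
      by (rule dir.nn_integral_fst[symmetric]) measurable
  qed
  finally show ?thesis .
qed

lemma F_joint_measurable [measurable (raw)]:
  assumes [measurable]: "g \<in> borel_measurable N" "k \<in> measurable N \<mu>"
  shows "(\<lambda>w. F (g w) (k w)) \<in> borel_measurable N"
proof -
  have "continuous_on UNIV (\<lambda>x. F x z)" if "z \<in> space \<mu>" for z
    using F_differentiable[OF that] by (simp add: differentiable_imp_continuous_within continuous_at_imp_continuous_on)
  then have "(\<lambda>(x, z). F x z) \<in> borel_measurable (borel \<Otimes>\<^sub>M \<mu>)"
    by (intro borel_measurable_caratheodory F_measurable)
  from measurable_compose[OF measurable_Pair[OF assms] this] show ?thesis by simp
qed

lemma column_measurable [measurable]: "column i \<in> borel_measurable (borel :: (real^'l^'d) measure)"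
proof -
  have "linear (column i :: real^'l^'d \<Rightarrow> real^'d)"
    by (rule linearI) (simp_all add: column_def vec_eq_iff)
  then show ?thesis
    by (intro borel_measurable_continuous_onI linear_continuous_on) (simp add: linear_conv_bounded_linear)
qed

lemma szd_direction_measurable [measurable (raw)]:
  fixes p :: "'v \<Rightarrow> real^'l^'d"
  assumes [measurable]: "y \<in> borel_measurable N" "z \<in> measurable N \<mu>" "p \<in> borel_measurable N"
  shows "(\<lambda>w. szd_direction (\<lambda>x. F x (z w)) hh (p w) (y w)) \<in> borel_measurable N"
  unfolding szd_direction_def by measurable

lemma x_0 [simp]: "x 0 \<omega> = x0" by (simp add: x_def)

lemma x_Suc:
  "x (Suc k) \<omega> = x k \<omega> - \<alpha> k *\<^sub>R szd_direction (\<lambda>y. F y (Zs k \<omega>)) (h k) (P k \<omega>) (x k \<omega>)"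
  by (simp add: x_def Let_def szd_direction_def)

lemma past_mono: "subalgebra (past (Suc k)) (past k)"
  unfolding past_def by (rule gen_algebra_mono) auto

lemma past_subalgebra: "subalgebra M (past k)"
  unfolding past_def by (rule gen_algebra_subalgebra)

lemma x_measurable_past: "x k \<in> borel_measurable (past k)"
proof (induction k)
  case 0
  have "x 0 = (\<lambda>_. x0)" by (simp add: fun_eq_iff)
  then show ?case by simp
next
  case (Suc k)
  have [measurable]: "x k \<in> borel_measurable (past (Suc k))"
    using past_mono Suc by (rule measurable_from_subalg)
  have [measurable]: "P k \<in> borel_measurable (past (Suc k))"
    unfolding past_def by (rule P_measurable_gen_algebra) auto
  have [measurable]: "Zs k \<in> measurable (past (Suc k)) \<mu>"
    unfolding past_def by (rule Zs_measurable_gen_algebra) auto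
  show ?case unfolding x_Suc[abs_def] by measurable
qed

lemma x_measurable [measurable]: "x k \<in> borel_measurable M"
  using past_subalgebra x_measurable_past by (rule measurable_from_subalg)

lemma f_measurable [measurable]: "f \<in> borel_measurable borel"
  by (rule borel_measurable_continuous_onI[OF continuous_on_f])

subsection \<open>Recursion in expectation and the averaged rate\<close>

lemma d_pos: "d > 0" and l_pos: "l > 0"
proof -
  interpret szd_step \<mu> F lam A B G f fstar "distr M borel (P 0)" d l by (rule szd_step)
  show "d > 0" "l > 0" by (rule dl_pos)+
qed

lemma \<alpha>_pos: "\<alpha> k > 0" and h_pos: "h k > 0"
  and \<alpha>_diverges: "filterlim (\<lambda>n. \<Sum>k<n. \<alpha> k) at_top sequentially"
  and \<alpha>_square_summable: "summable (\<lambda>k. (\<alpha> k)\<^sup>2)"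
  and \<alpha>h_summable: "summable (\<lambda>k. \<alpha> k * h k)"
  using summability unfolding summability_def by auto

lemma \<rho>_nonneg: "0 \<le> \<rho> k"
  unfolding \<rho>_def using lam d_pos l_pos \<alpha>_pos[of k] h_pos[of k] by simp

lemma W_nonneg: "0 \<le> W k"
  unfolding W_def using d_pos l_pos ABG by simp

lemma \<rho>_summable: "summable \<rho>"
  unfolding \<rho>_def[abs_def] mult.assoc[of _ "\<alpha> _"] by (intro summable_mult \<alpha>h_summable)

lemma W_summable: "summable W"
proof -
  \<comment> \<open>A summable nonnegative sequence is eventually below 1 and from then on dominates
    its squares.\<close>
  have "summable (\<lambda>k. (\<alpha> k * h k)\<^sup>2)"
  proof (rule summable_comparison_test_ev[OF _ \<alpha>h_summable])
    have "\<forall>\<^sub>F k in sequentially. \<alpha> k * h k < 1"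
      using summable_LIMSEQ_zero[OF \<alpha>h_summable] by (rule order_tendstoD) simp
    then show "\<forall>\<^sub>F k in sequentially. norm ((\<alpha> k * h k)\<^sup>2) \<le> \<alpha> k * h k"
    proof eventually_elim
      case (elim k)
      then have "(\<alpha> k * h k) * (\<alpha> k * h k) \<le> (\<alpha> k * h k) * 1"
        using \<alpha>_pos[of k] h_pos[of k] by (intro mult_left_mono) auto
      then show ?case by (simp add: power2_eq_square)
    qed
  qed
  then have "summable (\<lambda>k. d / l * (lam\<^sup>2 * d\<^sup>2 / (2 * l)) * (\<alpha> k * h k)\<^sup>2 + d / l * (2 * G) * (\<alpha> k)\<^sup>2)"
    by (intro summable_add summable_mult \<alpha>_square_summable)
  moreover have "W = (\<lambda>k. d / l * (lam\<^sup>2 * d\<^sup>2 / (2 * l)) * (\<alpha> k * h k)\<^sup>2 + d / l * (2 * G) * (\<alpha> k)\<^sup>2)"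
    by (simp add: W_def fun_eq_iff power_mult_distrib algebra_simps)
  ultimately show ?thesis by simp
qed

text \<open>The event \<open>U\<close> stands for conditioning on the past. Infinite values are
  allowed, because this inequality is what proves the next second moment finite.\<close>

lemma one_step_nn_integral:
  assumes xb: "xb \<in> argmin f" and \<delta>: "0 < \<delta>" "\<delta> \<le> 1 - d * (A + lam * B) * \<alpha>bar / l"
    and U: "U \<in> sets (past k)"
  shows "(\<integral>\<^sup>+\<omega>. indicator U \<omega> * ennreal ((norm (x (Suc k) \<omega> - xb))\<^sup>2) \<partial>M)
      + (\<integral>\<^sup>+\<omega>. indicator U \<omega> * ennreal (2 * \<alpha> k * \<delta> * (f (x k \<omega>) - fstar)) \<partial>M)
    \<le> (\<integral>\<^sup>+\<omega>. indicator U \<omega> * ennreal ((norm (x k \<omega> - xb))\<^sup>2 + \<rho> k * norm (x k \<omega> - xb) + W k) \<partial>M)"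
proof -
  interpret step: szd_step \<mu> F lam A B G f fstar "distr M borel (P k)" d l by (rule szd_step)
  \<comment> \<open>The step restriction is monotone in the step-size, so a \<open>\<delta>\<close>
    admissible for \<open>\<alpha>bar\<close> serves every step.\<close>
  have \<delta>k: "\<delta> \<le> 1 - \<alpha> k * (d / l) * (A + lam * B)"
  proof -
    have "\<alpha> k * (d / l * (A + lam * B)) \<le> \<alpha>bar * (d / l * (A + lam * B))"
      using d_pos l_pos ABG lam by (intro mult_right_mono \<alpha>_le) auto
    then show ?thesis using \<delta>(2) by (simp add: mult_ac)
  qed
  define \<phi> where "\<phi> = (\<lambda>(\<omega>, (z, p :: real^'l^'d)). indicator U \<omega> *
    ennreal ((norm (x k \<omega> - \<alpha> k *\<^sub>R szd_direction (\<lambda>y. F y z) (h k) p (x k \<omega>) - xb))\<^sup>2))"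
  have \<phi> [measurable]: "\<phi> \<in> borel_measurable (past k \<Otimes>\<^sub>M (\<mu> \<Otimes>\<^sub>M borel))"
  proof -
    \<comment> \<open>\<open>nn_integral_past\<close> asks for measurability with respect to the
      past, not merely with respect to \<open>M\<close>.\<close>
    note x_measurable [measurable del] x_measurable_past [measurable] U [measurable]
    show ?thesis unfolding \<phi>_def split_beta' by measurable
  qed
  have UM [measurable]: "U \<in> sets M" using U past_sets_subset by blast
  have "(\<integral>\<^sup>+\<omega>. indicator U \<omega> * ennreal ((norm (x (Suc k) \<omega> - xb))\<^sup>2) \<partial>M)
      = (\<integral>\<^sup>+\<omega>. \<phi> (\<omega>, (Zs k \<omega>, P k \<omega>)) \<partial>M)"
    by (simp add: \<phi>_def x_Suc)
  also have "\<dots> = (\<integral>\<^sup>+\<omega>. \<integral>\<^sup>+z. \<integral>\<^sup>+p. \<phi> (\<omega>, (z, p)) \<partial>distr M borel (P k) \<partial>\<mu> \<partial>M)" (is "_ = (\<integral>\<^sup>+\<omega>. ?\<Phi> \<omega> \<partial>M)")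
    by (rule nn_integral_past[OF \<phi>])
  finally have eq: "(\<integral>\<^sup>+\<omega>. indicator U \<omega> * ennreal ((norm (x (Suc k) \<omega> - xb))\<^sup>2) \<partial>M) = (\<integral>\<^sup>+\<omega>. ?\<Phi> \<omega> \<partial>M)" .
  have le: "?\<Phi> \<omega> + indicator U \<omega> * ennreal (2 * \<alpha> k * \<delta> * (f (x k \<omega>) - fstar))
      \<le> indicator U \<omega> * ennreal ((norm (x k \<omega> - xb))\<^sup>2 + \<rho> k * norm (x k \<omega> - xb) + W k)" for \<omega>
    using step.szd_step_expectation[OF xb h_pos \<alpha>_pos \<delta>(1) \<delta>k, of "x k \<omega>" k]
    by (cases "\<omega> \<in> U") (simp_all add: \<phi>_def \<rho>_def W_def)
  have sets_dir [measurable_cong]: "sets (distr M borel (P k)) = sets borel" by simp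
  have "(\<lambda>w. \<phi> (fst (fst w), (snd (fst w), snd w))) \<in> borel_measurable ((M \<Otimes>\<^sub>M \<mu>) \<Otimes>\<^sub>M distr M borel (P k))"
    unfolding \<phi>_def split_beta' by measurable
  then have "(\<lambda>w. \<integral>\<^sup>+p. \<phi> (fst w, (snd w, p)) \<partial>distr M borel (P k)) \<in> borel_measurable (M \<Otimes>\<^sub>M \<mu>)"
    by (rule step.dir.borel_measurable_nn_integral_fst[where f = "\<lambda>w. \<phi> (fst (fst w), (snd (fst w), snd w))", simplified])
  then have [measurable]: "?\<Phi> \<in> borel_measurable M"
    by (rule borel_measurable_nn_integral_fst[where f = "\<lambda>w. \<integral>\<^sup>+p. \<phi> (fst w, (snd w, p)) \<partial>distr M borel (P k)", simplified])
  show ?thesis unfolding eq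
    by (subst nn_integral_add[symmetric]) (measurable, intro nn_integral_mono le)
qed

text \<open>By induction: the right-hand side of the one-step inequality is finite once the second
  moment at \<open>k\<close> is, and it bounds the second moment at \<open>Suc k\<close>. The other
  two claims follow by domination.\<close>

lemma x_integrable:
  assumes xb: "xb \<in> argmin f"
  shows norm_x_square_integrable: "integrable M (\<lambda>\<omega>. (norm (x k \<omega> - xb))\<^sup>2)"
    and norm_x_integrable: "integrable M (\<lambda>\<omega>. norm (x k \<omega> - xb))"
    and f_x_integrable: "integrable M (\<lambda>\<omega>. f (x k \<omega>) - fstar)"
proof -
  have norm_int: "integrable M (\<lambda>\<omega>. norm (x k \<omega> - xb))" if "integrable M (\<lambda>\<omega>. (norm (x k \<omega> - xb))\<^sup>2)" for k
  proof (rule Bochner_Integration.integrable_bound)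
    show "integrable M (\<lambda>\<omega>. 1 + (norm (x k \<omega> - xb))\<^sup>2)" using that by simp
    have "t \<le> 1 + t\<^sup>2" if "0 \<le> t" for t :: real
      using zero_le_power2[of "t - 1"] that unfolding power2_diff by simp
    then show "AE \<omega> in M. norm (norm (x k \<omega> - xb)) \<le> norm (1 + (norm (x k \<omega> - xb))\<^sup>2)" by simp
  qed measurable
  show sq: "integrable M (\<lambda>\<omega>. (norm (x k \<omega> - xb))\<^sup>2)" for k
  proof (induction k)
    case (Suc k)
    let ?\<delta> = "1 - d * (A + lam * B) * \<alpha>bar / l"
    have \<delta>: "0 < ?\<delta>" using \<alpha>bar_bound by (simp add: mult_ac)
    have top: "space M \<in> sets (past k)" using sets.top[of "past k"] by (simp add: past_def)
    let ?R = "\<lambda>\<omega>. (norm (x k \<omega> - xb))\<^sup>2 + \<rho> k * norm (x k \<omega> - xb) + W k"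
    have "(\<integral>\<^sup>+\<omega>. ennreal ((norm (x (Suc k) \<omega> - xb))\<^sup>2) \<partial>M)
        = (\<integral>\<^sup>+\<omega>. indicator (space M) \<omega> * ennreal ((norm (x (Suc k) \<omega> - xb))\<^sup>2) \<partial>M)"
      by (intro nn_integral_cong) simp
    also have "\<dots> \<le> (\<integral>\<^sup>+\<omega>. indicator (space M) \<omega> * ennreal (?R \<omega>) \<partial>M)"
      by (rule order_trans[OF _ one_step_nn_integral[OF xb \<delta> order_refl top]]) (rule add_increasing2, auto)
    also have "\<dots> = (\<integral>\<^sup>+\<omega>. ennreal (?R \<omega>) \<partial>M)" by (intro nn_integral_cong) simp
    also have "\<dots> = ennreal (\<integral>\<omega>. ?R \<omega> \<partial>M)"
      using Suc norm_int[OF Suc] by (intro nn_integral_eq_integral) (auto simp: \<rho>_nonneg W_nonneg)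
    finally show ?case
      by (intro integrableI_nonneg) (auto simp: le_less_trans)
  qed simp
  show "integrable M (\<lambda>\<omega>. norm (x k \<omega> - xb))" by (rule norm_int[OF sq])
  show "integrable M (\<lambda>\<omega>. f (x k \<omega>) - fstar)"
  proof (rule Bochner_Integration.integrable_bound)
    show "integrable M (\<lambda>\<omega>. lam / 2 * (norm (x k \<omega> - xb))\<^sup>2)" using sq[of k] by simp
    have "\<bar>f y - fstar\<bar> \<le> lam / 2 * (norm (y - xb))\<^sup>2" for y
      using f_gap_le[OF xb, of y] fstar_le[of y] by simp
    then show "AE \<omega> in M. norm (f (x k \<omega>) - fstar) \<le> norm (lam / 2 * (norm (x k \<omega> - xb))\<^sup>2)"
      using lam by (simp add: abs_mult)
  qed measurable
qed

lemma one_step_expectation: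
  assumes xb: "xb \<in> argmin f" and \<delta>: "0 < \<delta>" "\<delta> \<le> 1 - d * (A + lam * B) * \<alpha>bar / l"
    and U: "U \<in> sets (past k)"
  shows "(\<integral>\<omega>. indicator U \<omega> * (norm (x (Suc k) \<omega> - xb))\<^sup>2 \<partial>M)
      + 2 * \<delta> * \<alpha> k * (\<integral>\<omega>. indicator U \<omega> * (f (x k \<omega>) - fstar) \<partial>M)
    \<le> (\<integral>\<omega>. indicator U \<omega> * (norm (x k \<omega> - xb))\<^sup>2 \<partial>M)
      + \<rho> k * sqrt (\<integral>\<omega>. (norm (x k \<omega> - xb))\<^sup>2 \<partial>M) + W k"
proof -
  have UM [measurable]: "U \<in> sets M" using U past_sets_subset by blast
  have int_ind: "integrable M (\<lambda>\<omega>. indicator U \<omega> * g \<omega>)" if "integrable M g" for g :: "'w \<Rightarrow> real"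
    using integrable_mult_indicator[OF UM that] by simp
  have enn: "(\<integral>\<^sup>+\<omega>. indicator U \<omega> * ennreal (g \<omega>) \<partial>M) = ennreal (\<integral>\<omega>. indicator U \<omega> * g \<omega> \<partial>M)"
    if "integrable M g" "\<And>\<omega>. 0 \<le> g \<omega>" for g :: "'w \<Rightarrow> real"
  proof -
    have "(\<integral>\<^sup>+\<omega>. indicator U \<omega> * ennreal (g \<omega>) \<partial>M) = (\<integral>\<^sup>+\<omega>. ennreal (indicator U \<omega> * g \<omega>) \<partial>M)"
      by (intro nn_integral_cong) (auto simp: indicator_def)
    also have "\<dots> = ennreal (\<integral>\<omega>. indicator U \<omega> * g \<omega> \<partial>M)"
      by (intro nn_integral_eq_integral int_ind that) (simp add: that indicator_def)
    finally show ?thesis .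
  qed
  note int = norm_x_square_integrable[OF xb] norm_x_integrable[OF xb] f_x_integrable[OF xb]
  let ?L = "\<lambda>\<omega>. 2 * \<alpha> k * \<delta> * (f (x k \<omega>) - fstar)"
  let ?R = "\<lambda>\<omega>. (norm (x k \<omega> - xb))\<^sup>2 + \<rho> k * norm (x k \<omega> - xb) + W k"
  have L0: "0 \<le> ?L \<omega>" for \<omega> using \<alpha>_pos[of k] \<delta>(1) fstar_le[of "x k \<omega>"] by simp
  have R0: "0 \<le> ?R \<omega>" for \<omega> using \<rho>_nonneg[of k] W_nonneg[of k] by simp
  have nn: "0 \<le> (\<integral>\<omega>. indicator U \<omega> * g \<omega> \<partial>M)" if "\<And>\<omega>. 0 \<le> g \<omega>" for g :: "'w \<Rightarrow> real"
    using that by (intro integral_nonneg_AE) (simp add: indicator_def)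
  have "ennreal (\<integral>\<omega>. indicator U \<omega> * (norm (x (Suc k) \<omega> - xb))\<^sup>2 \<partial>M) + ennreal (\<integral>\<omega>. indicator U \<omega> * ?L \<omega> \<partial>M)
      \<le> ennreal (\<integral>\<omega>. indicator U \<omega> * ?R \<omega> \<partial>M)"
    using one_step_nn_integral[OF assms] int L0 R0 by (simp add: enn)
  then have "(\<integral>\<omega>. indicator U \<omega> * (norm (x (Suc k) \<omega> - xb))\<^sup>2 \<partial>M) + (\<integral>\<omega>. indicator U \<omega> * ?L \<omega> \<partial>M)
      \<le> (\<integral>\<omega>. indicator U \<omega> * ?R \<omega> \<partial>M)"
    using nn[of "\<lambda>\<omega>. (norm (x (Suc k) \<omega> - xb))\<^sup>2"] nn[OF L0] nn[OF R0]
    by (simp add: ennreal_plus[symmetric] ennreal_le_iff del: ennreal_plus)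
  moreover have "(\<integral>\<omega>. indicator U \<omega> * ?L \<omega> \<partial>M) = 2 * \<delta> * \<alpha> k * (\<integral>\<omega>. indicator U \<omega> * (f (x k \<omega>) - fstar) \<partial>M)"
    unfolding integral_mult_right_zero[symmetric] by (intro Bochner_Integration.integral_cong) auto
  \<comment> \<open>The indicator is dropped from the error terms only. They become constants
    independent of \<open>U\<close>, as the supermartingale argument demands.\<close>
  moreover have "(\<integral>\<omega>. indicator U \<omega> * ?R \<omega> \<partial>M)
      \<le> (\<integral>\<omega>. indicator U \<omega> * (norm (x k \<omega> - xb))\<^sup>2 + (\<rho> k * norm (x k \<omega> - xb) + W k) \<partial>M)"
    using int \<rho>_nonneg[of k] W_nonneg[of k]
    by (intro integral_mono int_ind Bochner_Integration.integrable_add integrable_mult_right)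
       (auto simp: indicator_def)
  moreover have "\<dots> = (\<integral>\<omega>. indicator U \<omega> * (norm (x k \<omega> - xb))\<^sup>2 \<partial>M)
      + (\<rho> k * (\<integral>\<omega>. norm (x k \<omega> - xb) \<partial>M) + W k)"
    using int int_ind[OF int(1)] by (simp add: M.prob_space)
  moreover have "\<rho> k * (\<integral>\<omega>. norm (x k \<omega> - xb) \<partial>M) \<le> \<rho> k * sqrt (\<integral>\<omega>. (norm (x k \<omega> - xb))\<^sup>2 \<partial>M)"
    using int \<rho>_nonneg[of k] by (intro mult_left_mono M.expectation_le_sqrt) auto
  ultimately show ?thesis by linarith
qed

definition S :: "real^'d \<Rightarrow> nat \<Rightarrow> real" where
  "S xb k = (norm (x0 - xb))\<^sup>2 + (\<Sum>j=0..k. W j)"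

lemma mono_S: "mono (S xb)"
  unfolding S_def by (intro monoI add_left_mono sum_mono2) (auto simp: W_nonneg)

context
  fixes xb \<delta>
  assumes xb: "xb \<in> argmin f" and \<delta>: "0 < \<delta>" "\<delta> \<le> 1 - d * (A + lam * B) * \<alpha>bar / l"
begin

text \<open>Telescoped one-step inequality with two uses: discarding the gap sum controls second
  moments, discarding the second moment controls the gap sum.\<close>

lemma expectation_recursion:
  "(\<integral>\<omega>. (norm (x (Suc k) \<omega> - xb))\<^sup>2 \<partial>M) + 2 * \<delta> * (\<Sum>j=0..k. \<alpha> j * (\<integral>\<omega>. f (x j \<omega>) - fstar \<partial>M))
    \<le> S xb k + (\<Sum>j=0..k. \<rho> j * sqrt (\<integral>\<omega>. (norm (x j \<omega> - xb))\<^sup>2 \<partial>M))"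
proof -
  have step: "(\<integral>\<omega>. (norm (x (Suc k) \<omega> - xb))\<^sup>2 \<partial>M) + 2 * \<delta> * \<alpha> k * (\<integral>\<omega>. f (x k \<omega>) - fstar \<partial>M)
      \<le> (\<integral>\<omega>. (norm (x k \<omega> - xb))\<^sup>2 \<partial>M) + \<rho> k * sqrt (\<integral>\<omega>. (norm (x k \<omega> - xb))\<^sup>2 \<partial>M) + W k" for k
  proof -
    have "space M \<in> sets (past k)" using sets.top[of "past k"] by (simp add: past_def)
    moreover have "(\<integral>\<omega>. indicator (space M) \<omega> * g \<omega> \<partial>M) = (\<integral>\<omega>. g \<omega> \<partial>M)" for g :: "'w \<Rightarrow> real"
      by (intro Bochner_Integration.integral_cong) auto
    ultimately show ?thesis using one_step_expectation[OF xb \<delta>, of "space M" k] by simp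
  qed
  show ?thesis
  proof (induction k)
    case 0
    show ?case using step[of 0] by (simp add: S_def M.prob_space)
  next
    case (Suc k)
    then show ?case using step[of "Suc k"] by (simp add: S_def algebra_simps)
  qed
qed

lemma gap_sum_nonneg: "0 \<le> (\<Sum>j=0..k. \<alpha> j * (\<integral>\<omega>. f (x j \<omega>) - fstar \<partial>M))"
  by (intro sum_nonneg mult_nonneg_nonneg integral_nonneg_AE) (auto simp: fstar_le less_imp_le[OF \<alpha>_pos])

lemma expectation_norm_bound:
  "sqrt (\<integral>\<omega>. (norm (x k \<omega> - xb))\<^sup>2 \<partial>M) \<le> sqrt (S xb k) + (\<Sum>j=0..k. \<rho> j)"
proof (rule sqrt_bound_of_recursion)
  show "(\<integral>\<omega>. (norm (x (Suc k) \<omega> - xb))\<^sup>2 \<partial>M)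
      \<le> S xb k + (\<Sum>j=0..k. \<rho> j * sqrt (\<integral>\<omega>. (norm (x j \<omega> - xb))\<^sup>2 \<partial>M))" for k
    using expectation_recursion[of k] gap_sum_nonneg[of k] \<delta>(1)
    by (smt (verit) mult_nonneg_nonneg)
  show "(\<integral>\<omega>. (norm (x 0 \<omega> - xb))\<^sup>2 \<partial>M) \<le> S xb 0"
    using W_nonneg[of 0] by (simp add: S_def M.prob_space)
qed (auto simp: mono_S \<rho>_nonneg)

lemma gap_sum_bound:
  "2 * \<delta> * (\<Sum>j=0..k. \<alpha> j * (\<integral>\<omega>. f (x j \<omega>) - fstar \<partial>M))
    \<le> S xb k + (\<Sum>j=0..k. \<rho> j * (sqrt (S xb j) + (\<Sum>i=0..j. \<rho> i)))"
proof -
  have "(\<Sum>j=0..k. \<rho> j * sqrt (\<integral>\<omega>. (norm (x j \<omega> - xb))\<^sup>2 \<partial>M))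
      \<le> (\<Sum>j=0..k. \<rho> j * (sqrt (S xb j) + (\<Sum>i=0..j. \<rho> i)))"
    by (intro sum_mono mult_left_mono expectation_norm_bound \<rho>_nonneg)
  moreover have "0 \<le> (\<integral>\<omega>. (norm (x (Suc k) \<omega> - xb))\<^sup>2 \<partial>M)" by simp
  ultimately show ?thesis using expectation_recursion[of k] by linarith
qed

text \<open>Jensen with weights \<open>\<alpha> j / T\<close> bounds the gap at the average by the
  averaged gaps \<open>avg\<close>. As the gap is nonnegative, \<open>avg\<close> also dominates it
  for integrability.\<close>

lemma averaged_rate:
  defines "xhat \<equiv> (\<lambda>k \<omega>. (1 / (\<Sum>j=0..k. \<alpha> j)) *\<^sub>R (\<Sum>j=0..k. \<alpha> j *\<^sub>R x j \<omega>))"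
  shows "integrable M (\<lambda>\<omega>. f (xhat k \<omega>) - fstar)"
    and "(\<integral>\<omega>. (f (xhat k \<omega>) - fstar) \<partial>M) \<le> 1 / (2 * \<delta> * (\<Sum>j=0..k. \<alpha> j)) *
            (S xb k + (\<Sum>j=0..k. \<rho> j * (sqrt (S xb j) + (\<Sum>i=0..j. \<rho> i))))"
proof -
  define T where "T = (\<Sum>j=0..k. \<alpha> j)"
  have T: "T > 0" unfolding T_def by (intro sum_pos \<alpha>_pos) auto
  define avg where "avg \<omega> = (1 / T) * (\<Sum>j=0..k. \<alpha> j * (f (x j \<omega>) - fstar))" for \<omega>
  have int_avg: "integrable M avg"
    unfolding avg_def by (intro integrable_mult_right Bochner_Integration.integrable_sum f_x_integrable[OF xb])
  have [measurable]: "xhat k \<in> borel_measurable M" unfolding xhat_def by measurable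
  have le: "f (xhat k \<omega>) - fstar \<le> avg \<omega>" for \<omega>
  proof -
    have "xhat k \<omega> = (\<Sum>j=0..k. (\<alpha> j / T) *\<^sub>R x j \<omega>)"
      unfolding xhat_def T_def by (simp add: scaleR_sum_right)
    also have "f \<dots> \<le> (\<Sum>j=0..k. (\<alpha> j / T) * f (x j \<omega>))"
      using T less_imp_le[OF \<alpha>_pos]
      by (intro convex_on_sum[OF _ _ convex_on_f]) (auto simp: sum_divide_distrib[symmetric] T_def)
    also have "\<dots> = avg \<omega> + (\<Sum>j=0..k. \<alpha> j) / T * fstar"
      unfolding avg_def by (simp add: algebra_simps sum_subtractf sum_distrib_left sum_divide_distrib diff_divide_distrib)
    finally show ?thesis using T unfolding T_def by simp
  qed
  show int: "integrable M (\<lambda>\<omega>. f (xhat k \<omega>) - fstar)"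
  proof (rule Bochner_Integration.integrable_bound[OF int_avg])
    show "AE \<omega> in M. norm (f (xhat k \<omega>) - fstar) \<le> norm (avg \<omega>)"
    proof (rule AE_I2)
      fix \<omega>
      show "norm (f (xhat k \<omega>) - fstar) \<le> norm (avg \<omega>)" using le[of \<omega>] fstar_le[of "xhat k \<omega>"] by simp
    qed
  qed measurable
  have "(\<integral>\<omega>. (f (xhat k \<omega>) - fstar) \<partial>M) \<le> (\<integral>\<omega>. avg \<omega> \<partial>M)"
    by (intro integral_mono int int_avg le)
  also have "\<dots> = (1 / T) * (\<Sum>j=0..k. \<alpha> j * (\<integral>\<omega>. f (x j \<omega>) - fstar \<partial>M))"
    unfolding avg_def by (simp add: f_x_integrable[OF xb] del: Bochner_Integration.integral_diff)
  also have "\<dots> = 1 / (2 * \<delta> * T) * (2 * \<delta> * (\<Sum>j=0..k. \<alpha> j * (\<integral>\<omega>. f (x j \<omega>) - fstar \<partial>M)))"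
    using \<delta>(1) by simp
  also have "\<dots> \<le> 1 / (2 * \<delta> * T) * (S xb k + (\<Sum>j=0..k. \<rho> j * (sqrt (S xb j) + (\<Sum>i=0..j. \<rho> i))))"
    using \<delta>(1) T by (intro mult_left_mono gap_sum_bound) auto
  finally show "(\<integral>\<omega>. (f (xhat k \<omega>) - fstar) \<partial>M) \<le> 1 / (2 * \<delta> * (\<Sum>j=0..k. \<alpha> j)) *
            (S xb k + (\<Sum>j=0..k. \<rho> j * (sqrt (S xb j) + (\<Sum>i=0..j. \<rho> i))))"
    unfolding T_def .
qed

end

subsection \<open>Almost sure convergence\<close>

context
  fixes xb assumes xb: "xb \<in> argmin f"
begin

text \<open>Uniformity in \<open>k\<close> makes the errors \<open>\<rho> k\<close> times this bound
  summable.\<close>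

lemma expectation_norm_bounded:
  "sqrt (\<integral>\<omega>. (norm (x k \<omega> - xb))\<^sup>2 \<partial>M) \<le> sqrt ((norm (x0 - xb))\<^sup>2 + suminf W) + suminf \<rho>"
proof -
  have "sqrt (\<integral>\<omega>. (norm (x k \<omega> - xb))\<^sup>2 \<partial>M) \<le> sqrt (S xb k) + (\<Sum>j=0..k. \<rho> j)"
    by (rule expectation_norm_bound[OF xb _ order_refl]) (use \<alpha>bar_bound in \<open>simp add: mult_ac\<close>)
  also have "\<dots> \<le> sqrt ((norm (x0 - xb))\<^sup>2 + suminf W) + suminf \<rho>"
    unfolding S_def
    by (intro add_mono real_sqrt_le_mono sum_le_suminf W_summable \<rho>_summable)
       (auto simp: W_nonneg \<rho>_nonneg)
  finally show ?thesis .
qed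

lemma norm_x_square_converges: "AE \<omega> in M. convergent (\<lambda>k. (norm (x k \<omega> - xb))\<^sup>2)"
proof (rule M.almost_supermartingale_converges[where Fi = past
      and c = "\<lambda>k. \<rho> k * (sqrt ((norm (x0 - xb))\<^sup>2 + suminf W) + suminf \<rho>) + W k"])
  let ?\<delta> = "1 - d * (A + lam * B) * \<alpha>bar / l"
  have \<delta>: "0 < ?\<delta>" using \<alpha>bar_bound by (simp add: mult_ac)
  show "(\<lambda>\<omega>. (norm (x k \<omega> - xb))\<^sup>2) \<in> borel_measurable (past k)" for k
    using x_measurable_past[of k] by measurable
  fix k U assume U: "U \<in> sets (past k)"
  have "0 \<le> 2 * ?\<delta> * \<alpha> k * (\<integral>\<omega>. indicator U \<omega> * (f (x k \<omega>) - fstar) \<partial>M)"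
    using \<delta> \<alpha>_pos[of k]
    by (intro mult_nonneg_nonneg integral_nonneg_AE) (auto simp: fstar_le indicator_def)
  moreover have "\<rho> k * sqrt (\<integral>\<omega>. (norm (x k \<omega> - xb))\<^sup>2 \<partial>M)
      \<le> \<rho> k * (sqrt ((norm (x0 - xb))\<^sup>2 + suminf W) + suminf \<rho>)"
    by (intro mult_left_mono expectation_norm_bounded \<rho>_nonneg)
  ultimately show "(\<integral>\<omega>. indicator U \<omega> * (norm (x (Suc k) \<omega> - xb))\<^sup>2 \<partial>M)
      \<le> (\<integral>\<omega>. indicator U \<omega> * (norm (x k \<omega> - xb))\<^sup>2 \<partial>M)
        + (\<rho> k * (sqrt ((norm (x0 - xb))\<^sup>2 + suminf W) + suminf \<rho>) + W k)"
    using one_step_expectation[OF xb \<delta> order_refl U] by linarith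
next
  show "summable (\<lambda>k. \<rho> k * (sqrt ((norm (x0 - xb))\<^sup>2 + suminf W) + suminf \<rho>) + W k)"
    by (intro summable_add summable_mult2 \<rho>_summable W_summable)
  have "0 \<le> sqrt ((norm (x0 - xb))\<^sup>2 + suminf W) + suminf \<rho>"
    by (intro add_nonneg_nonneg real_sqrt_ge_zero suminf_nonneg W_summable \<rho>_summable W_nonneg \<rho>_nonneg) auto
  then show "0 \<le> \<rho> k * (sqrt ((norm (x0 - xb))\<^sup>2 + suminf W) + suminf \<rho>) + W k" for k
    using \<rho>_nonneg[of k] W_nonneg[of k] by simp
qed (auto simp: past_subalgebra past_mono norm_x_square_integrable[OF xb])

lemma gap_AE_summable: "AE \<omega> in M. summable (\<lambda>k. \<alpha> k * (f (x k \<omega>) - fstar))"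
proof (rule M.AE_summable)
  show "integrable M (\<lambda>\<omega>. \<alpha> k * (f (x k \<omega>) - fstar))" for k
    by (intro integrable_mult_right f_x_integrable[OF xb])
  show "0 \<le> \<alpha> k * (f (x k \<omega>) - fstar)" for k \<omega>
    using \<alpha>_pos[of k] fstar_le[of "x k \<omega>"] by simp
  let ?\<delta> = "1 - d * (A + lam * B) * \<alpha>bar / l"
  let ?K = "sqrt ((norm (x0 - xb))\<^sup>2 + suminf W) + suminf \<rho>"
  let ?C = "((norm (x0 - xb))\<^sup>2 + suminf W + suminf \<rho> * ?K) / (2 * ?\<delta>)"
  let ?gap = "\<lambda>k. \<alpha> k * (\<integral>\<omega>. f (x k \<omega>) - fstar \<partial>M)"
  have \<delta>: "0 < ?\<delta>" using \<alpha>bar_bound by (simp add: mult_ac)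
  have gap0: "0 \<le> ?gap k" for k
    by (intro mult_nonneg_nonneg integral_nonneg_AE) (auto simp: fstar_le less_imp_le[OF \<alpha>_pos])
  have bound: "sum ?gap {0..k} \<le> ?C" for k
  proof -
    have K: "0 \<le> ?K"
      by (intro add_nonneg_nonneg real_sqrt_ge_zero suminf_nonneg W_summable \<rho>_summable W_nonneg \<rho>_nonneg) auto
    have "0 \<le> (\<integral>\<omega>. (norm (x (Suc k) \<omega> - xb))\<^sup>2 \<partial>M)" by simp
    then have "2 * ?\<delta> * sum ?gap {0..k}
        \<le> S xb k + (\<Sum>j=0..k. \<rho> j * sqrt (\<integral>\<omega>. (norm (x j \<omega> - xb))\<^sup>2 \<partial>M))"
      using expectation_recursion[OF xb \<delta> order_refl, of k] by linarith
    also have "\<dots> \<le> S xb k + (\<Sum>j=0..k. \<rho> j * ?K)"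
      by (intro add_left_mono sum_mono mult_left_mono expectation_norm_bounded \<rho>_nonneg)
    also have "\<dots> \<le> (norm (x0 - xb))\<^sup>2 + suminf W + suminf \<rho> * ?K"
      unfolding S_def sum_distrib_right[symmetric]
      by (intro add_mono mult_right_mono sum_le_suminf W_summable \<rho>_summable K order_refl)
         (auto simp: W_nonneg \<rho>_nonneg)
    finally have le: "2 * ?\<delta> * sum ?gap {0..k} \<le> (norm (x0 - xb))\<^sup>2 + suminf W + suminf \<rho> * ?K" .
    have "0 < 2 * ?\<delta>" using \<delta> by simp
    from iffD2[OF pos_le_divide_eq[OF this] le[unfolded mult.commute[of "2 * ?\<delta>"]]] show ?thesis .
  qed
  have "summable ?gap"
  proof (rule summableI_nonneg_bounded[OF gap0])
    fix n
    have "sum ?gap {..<n} \<le> sum ?gap {0..n}" by (intro sum_mono2 gap0) auto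
    also note bound
    finally show "sum ?gap {..<n} \<le> ?C" .
  qed
  then show "summable (\<lambda>k. \<integral>\<omega>. \<alpha> k * (f (x k \<omega>) - fstar) \<partial>M)"
    by (simp del: Bochner_Integration.integral_diff)
qed

end

text \<open>The null set on which distances fail to converge depends on the minimizer. Only
  countably many null sets can be united, hence the countable dense \<open>D\<close>.\<close>

lemma x_AE_converges: "AE \<omega> in M. \<exists>y\<in>argmin f. (\<lambda>k. x k \<omega>) \<longlonglongrightarrow> y"
proof -
  obtain D where D: "countable D" "D \<subseteq> argmin f" "argmin f \<subseteq> closure D"
    by (rule separable)
  obtain xb where xb: "xb \<in> argmin f" using argmin_nonempty by blast
  have "AE \<omega> in M. \<forall>s\<in>D. convergent (\<lambda>k. (norm (x k \<omega> - s))\<^sup>2)"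
    unfolding AE_ball_countable[OF D(1)] using D(2) norm_x_square_converges by blast
  with gap_AE_summable[OF xb] show ?thesis
  proof eventually_elim
    case (elim \<omega>)
    obtain y where "f y = fstar" "(\<lambda>k. x k \<omega>) \<longlonglongrightarrow> y"
    proof (rule converges_to_argmin[where f = f and m = fstar and D = D and \<alpha> = \<alpha> and x = "\<lambda>k. x k \<omega>"])
      show "{y. f y = fstar} \<noteq> {}" "D \<subseteq> {y. f y = fstar}" "{y. f y = fstar} \<subseteq> closure D"
        using D argmin_nonempty by (auto simp: argmin_f)
    qed (use elim in \<open>auto simp: continuous_on_f fstar_le \<alpha>_pos \<alpha>_diverges\<close>)
    then show ?case by (auto simp: argmin_f)
  qed
qed

lemma f_x_AE_converges: "AE \<omega> in M. (\<lambda>k. f (x k \<omega>)) \<longlonglongrightarrow> fstar"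
  using x_AE_converges
proof eventually_elim
  case (elim \<omega>)
  then obtain y where y: "y \<in> argmin f" "(\<lambda>k. x k \<omega>) \<longlonglongrightarrow> y" by blast
  have "(\<lambda>k. f (x k \<omega>)) \<longlonglongrightarrow> f y" using continuous_on_tendsto_compose[OF continuous_on_f y(2)] by simp
  then show ?case using f_argmin[OF y(1)] by simp
qed

lemma x_limit:
  "\<exists>xstar. xstar \<in> borel_measurable M \<and> (\<forall>\<omega>\<in>space M. xstar \<omega> \<in> argmin f) \<and>
    (AE \<omega> in M. (\<lambda>k. x k \<omega>) \<longlonglongrightarrow> xstar \<omega>)"
proof -
  obtain xb where xb: "xb \<in> argmin f" using argmin_nonempty by blast
  \<comment> \<open>Off the convergence event \<open>lim\<close> is unspecified; the fixed minimizer
    \<open>xb\<close> is the fallback, so that \<open>xstar\<close> takes values in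
    \<open>argmin f\<close> everywhere and stays measurable.\<close>
  define xstar where "xstar \<omega> = (if f (lim (\<lambda>k. x k \<omega>)) = fstar then lim (\<lambda>k. x k \<omega>) else xb)" for \<omega>
  have [measurable]: "(\<lambda>\<omega>. lim (\<lambda>k. x k \<omega>)) \<in> borel_measurable M"
    by (rule borel_measurable_lim_metric) (rule x_measurable)
  have "xstar \<in> borel_measurable M" unfolding xstar_def by measurable
  moreover have "\<forall>\<omega>. xstar \<omega> \<in> argmin f" using xb by (simp add: xstar_def argmin_f)
  moreover have "AE \<omega> in M. (\<lambda>k. x k \<omega>) \<longlonglongrightarrow> xstar \<omega>"
    using x_AE_converges
  proof eventually_elim
    case (elim \<omega>)
    then obtain y where "y \<in> argmin f" "(\<lambda>k. x k \<omega>) \<longlonglongrightarrow> y" by blast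
    then show ?case by (simp add: xstar_def argmin_f limI)
  qed
  ultimately show ?thesis by blast
qed

end

section \<open>Passage from the random variables to their laws\<close>

lemma continuous_on_matrix_mult_transpose:
  "continuous_on UNIV (\<lambda>p :: real^'l^'d. p ** transpose p)"
  "continuous_on UNIV (\<lambda>p :: real^'l^'d. transpose p ** p)"
  unfolding matrix_matrix_mult_def transpose_def
  by (intro continuous_intros | simp)+

theorem theorem1:
  fixes M :: "'w measure" and \<Z> :: "'z measure"
    and Z :: "'w \<Rightarrow> 'z" and Zs :: "nat \<Rightarrow> 'w \<Rightarrow> 'z"
    and F :: "real^'d \<Rightarrow> 'z \<Rightarrow> real"
    and P :: "nat \<Rightarrow> 'w \<Rightarrow> real^'l^'d"
    and \<alpha> h :: "nat \<Rightarrow> real"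
    and lam A B G \<alpha>bar d l :: real
    and x0 :: "real^'d"
  defines "d \<equiv> real CARD('d)" and "l \<equiv> real CARD('l)"
  defines "f \<equiv> objective M Z F"
  defines "fstar \<equiv> (INF y. f y)"
  defines "x \<equiv> (\<lambda>k \<omega>. sszd F \<alpha> h (\<lambda>j. P j \<omega>) (\<lambda>j. Zs j \<omega>) x0 k)"
  defines "xhat \<equiv> (\<lambda>k \<omega>. (1 / (\<Sum>j=0..k. \<alpha> j)) *\<^sub>R (\<Sum>j=0..k. \<alpha> j *\<^sub>R x j \<omega>))"
  defines "W \<equiv> (\<lambda>k. d / l * (lam\<^sup>2 * d\<^sup>2 / (2 * l) * (h k)\<^sup>2 + 2 * G) * (\<alpha> k)\<^sup>2)"
  defines "\<rho> \<equiv> (\<lambda>k. lam * d * sqrt d / l * \<alpha> k * h k)"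
  defines "S \<equiv> (\<lambda>xbar k. (norm (x0 - xbar))\<^sup>2 + (\<Sum>j=0..k. W j))"
  assumes dims: "CARD('l) \<le> CARD('d)"
    and prob: "prob_space M"
    and Z_rv: "Z \<in> measurable M \<Z>"
    and F_meas: "\<And>y. F y \<in> borel_measurable \<Z>"
    and smooth: "smoothness_ABG M \<Z> Z F lam A B G"
    and convex: "\<And>z. z \<in> space \<Z> \<Longrightarrow> convex_on UNIV (\<lambda>y. F y z)"
    and summab: "summability \<alpha> h"
    and indep: "prob_space.mutually_indep M P borel Zs \<Z>"
    and Zs_copies: "\<And>k. distr M \<Z> (Zs k) = distr M \<Z> Z"
    and P_mean: "\<And>k. (\<integral>\<omega>. P k \<omega> ** transpose (P k \<omega>) \<partial>M) = mat 1"
    and P_orth: "\<And>k. AE \<omega> in M. transpose (P k \<omega>) ** P k \<omega> = (d / l) *\<^sub>R mat 1"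
    and \<alpha>bar_pos: "\<alpha>bar > 0"
    and \<alpha>bar_bound: "\<alpha>bar * d * (A + lam * B) / l < 1"
    and \<alpha>_le: "\<And>k. \<alpha> k \<le> \<alpha>bar"
  shows "(AE \<omega> in M. (\<lambda>k. f (x k \<omega>)) \<longlonglongrightarrow> fstar) \<and>
    (\<exists>xstar. xstar \<in> borel_measurable M \<and> (\<forall>\<omega>\<in>space M. xstar \<omega> \<in> argmin f) \<and>
       (AE \<omega> in M. (\<lambda>k. x k \<omega>) \<longlonglongrightarrow> xstar \<omega>)) \<and>
    (\<forall>\<delta>\<in>{0<..1 - d * (A + lam * B) * \<alpha>bar / l}. \<forall>xbar\<in>argmin f. \<forall>k.
       integrable M (\<lambda>\<omega>. f (xhat k \<omega>) - fstar) \<and>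
       (\<integral>\<omega>. (f (xhat k \<omega>) - fstar) \<partial>M)
         \<le> 1 / (2 * \<delta> * (\<Sum>j=0..k. \<alpha> j)) *
            (S xbar k + (\<Sum>j=0..k. \<rho> j * (sqrt (S xbar j) + (\<Sum>i=0..j. \<rho> i)))))"
proof -
  interpret M: prob_space M by (rule prob)
  let ?\<mu> = "distr M \<Z> Z"
  note [measurable] = Z_rv F_meas
  have P_rv [measurable]: "P k \<in> borel_measurable M" and Zs_rv: "Zs k \<in> measurable M \<Z>" for k
    using indep unfolding M.mutually_indep_def by auto
  have int_eq: "integrable ?\<mu> g \<longleftrightarrow> integrable M (\<lambda>\<omega>. g (Z \<omega>))"
    if "g \<in> borel_measurable \<Z>" for g :: "'z \<Rightarrow> real"
    using Z_rv that by (rule integrable_distr_eq)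
  have E_eq: "(\<integral>z. g z \<partial>?\<mu>) = (\<integral>\<omega>. g (Z \<omega>) \<partial>M)"
    if "g \<in> borel_measurable \<Z>" for g :: "'z \<Rightarrow> real"
    using Z_rv that by (rule integral_distr)
  have f_eq: "f = (\<lambda>x. \<integral>z. F x z \<partial>?\<mu>)"
    unfolding f_def objective_def by (simp add: E_eq F_meas fun_eq_iff)
  note sm = smooth[unfolded smoothness_ABG_def Let_def, folded f_def, folded fstar_def]
  have gradF_meas: "(\<lambda>z. (norm (gradient (\<lambda>x. F x z) y))\<^sup>2) \<in> borel_measurable \<Z>" for y
  proof -
    have "(\<lambda>z. gradient (\<lambda>x. F x z) y) \<in> borel_measurable \<Z>"
      using sm F_meas by (intro gradient_measurable) auto
    then show ?thesis by measurable
  qed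
  interpret ssc: stochastic_smooth_convex ?\<mu> F lam A B G f fstar
  proof (intro stochastic_smooth_convex.intro stochastic_smooth_convex_axioms.intro)
    show "prob_space ?\<mu>" using Z_rv by (rule M.prob_space_distr)
    show "f = (\<lambda>x. \<integral>z. F x z \<partial>?\<mu>)" by (rule f_eq)
    show "fstar = (INF x. f x)" by (simp add: fstar_def)
  qed (use sm convex in \<open>auto simp: int_eq E_eq gradF_meas\<close>)
  have step: "szd_step ?\<mu> F lam A B G f fstar (distr M borel (P k)) d l" for k
  proof (intro szd_step.intro szd_step_axioms.intro)
    show "(\<integral>p. p ** transpose p \<partial>distr M borel (P k)) = mat 1"
      using P_mean[of k] continuous_on_matrix_mult_transpose(1)
      by (subst integral_distr[OF P_rv]) (auto intro: borel_measurable_continuous_onI)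
    \<comment> \<open>Closedness makes the orthogonality condition a Borel event, so it can be
      transferred to the law of \<open>P k\<close>.\<close>
    have "closed {p :: real^'l^'d. transpose p ** p = (d / l) *\<^sub>R mat 1}"
      using closed_Collect_eq[OF continuous_on_matrix_mult_transpose(2) continuous_on_const] .
    then show "AE p in distr M borel (P k). transpose p ** p = (d / l) *\<^sub>R mat 1"
      using P_orth[of k] by (subst AE_distr_iff[OF P_rv]) auto
  qed (simp_all add: ssc.stochastic_smooth_convex_axioms M.prob_space_distr d_def l_def)
  interpret proc: sszd_process ?\<mu> F lam A B G f fstar M P Zs \<alpha> h x0 d l \<alpha>bar
  proof (intro sszd_process.intro sszd_process_axioms.intro)
    show "M.mutually_indep P borel Zs ?\<mu>" using indep by (simp add: M.mutually_indep_def)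
    show "distr M ?\<mu> (Zs k) = ?\<mu>" for k
      unfolding Zs_copies[of k, symmetric] by (intro distr_cong) auto
  qed (use step summab \<alpha>bar_bound \<alpha>_le in \<open>simp_all add: ssc.stochastic_smooth_convex_axioms prob\<close>)
  have x_eq: "x = proc.x" by (simp add: x_def proc.x_def fun_eq_iff)
  have \<rho>_eq: "\<rho> = proc.\<rho>" by (simp add: \<rho>_def proc.\<rho>_def fun_eq_iff)
  have W_eq: "W = proc.W" by (simp add: W_def proc.W_def fun_eq_iff)
  have S_eq: "S = proc.S" by (simp add: S_def proc.S_def W_eq fun_eq_iff)
  show ?thesis
    unfolding xhat_def x_eq \<rho>_eq S_eq
  proof (intro conjI ballI allI)
    fix \<delta> xbar k
    assume \<delta>: "\<delta> \<in> {0<..1 - d * (A + lam * B) * \<alpha>bar / l}" and xbar: "xbar \<in> argmin f"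
    note rate = proc.averaged_rate[OF xbar, of \<delta> k]
    show "integrable M (\<lambda>\<omega>. f ((1 / (\<Sum>j=0..k. \<alpha> j)) *\<^sub>R (\<Sum>j=0..k. \<alpha> j *\<^sub>R proc.x j \<omega>)) - fstar)"
      using \<delta> by (intro rate(1)) auto
    show "(\<integral>\<omega>. (f ((1 / (\<Sum>j=0..k. \<alpha> j)) *\<^sub>R (\<Sum>j=0..k. \<alpha> j *\<^sub>R proc.x j \<omega>)) - fstar) \<partial>M)
         \<le> 1 / (2 * \<delta> * (\<Sum>j=0..k. \<alpha> j)) *
            (proc.S xbar k + (\<Sum>j=0..k. proc.\<rho> j * (sqrt (proc.S xbar j) + (\<Sum>i=0..j. proc.\<rho> i))))"
      using \<delta> by (intro rate(2)) auto
  qed (rule proc.f_x_AE_converges proc.x_limit)+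
qed

end
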